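(* Let $p$ be even and consider the Rademacher-spiked tensor model. Let $\ell$ be an integer with $p/2 \le \ell \le n - p/2$, let $\mathbf{M}$ be the order-$\ell$ symmetric difference matrix of $\mathbf{Y}$, and let $d_\ell = \binom{n-\ell}{p/2}\binom{\ell}{p/2}$. For all $\lambda \ge 0$, \[\mathbb{P}_0\Big(\lambda_{\max}(\mathbf{M}) \ge \tfrac{\lambda d_\ell}{2}\Big) \vee \mathbb{P}_\lambda\Big(\lambda_{\max}(\mathbf{M}) \le \tfrac{\lambda d_\ell}{2}\Big) \le 2 n^\ell e^{-\lambda^2 d_\ell/8}.\] Consequently, the test that outputs $1$ if $\lambda_{\max}(\mathbf{M}) \ge \lambda d_\ell/2$ and $0$ otherwise achieves strong detection between $\mathbb{P}_0$ and $\mathbb{P}_\lambda$ whenever $\frac18\lambda^2 d_\ell - \ell\log n \to +\infty$ as $n \to \infty$.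
   Context: Rademacher-spiked tensor model: for $\lambda \ge 0$, draw $\mathbf{x}_*$ uniformly from $\{\pm1\}^n$ and set $\mathbf{Y} = \lambda \mathbf{x}_*^{\otimes p} + \mathbf{G}$, where $\mathbf{G} = \frac{1}{\sqrt{p!}}\sum_{\pi\in S_p}\widetilde{\mathbf{G}}^\pi$ with $\widetilde{\mathbf{G}}$ having i.i.d. $\mathcal{N}(0,1)$ entries and $\widetilde{\mathbf{G}}^\pi_{i_1,\ldots,i_p}=\widetilde{\mathbf{G}}_{i_{\pi(1)},\ldots,i_{\pi(p)}}$. $\mathbb{P}_\lambda$ denotes the law of $\mathbf{Y}$ ($\mathbb{P}_0$ is the null, pure-noise law). For $E = \{i_1,\ldots,i_p\} \subseteq [n]$ with distinct elements write $\mathbf{Y}_E = \mathbf{Y}_{i_1,\ldots,i_p}$ (well defined by symmetry); thus $\mathbf{Y}_E = \lambda \prod_{i\in E}(\mathbf{x}_* )_i + \mathbf{G}_E$ with $(\mathbf{G}_E)_{|E|=p}$ i.i.d. $\mathcal{N}(0,1)$. The order-$\ell$ symmetric difference matrix $\mathbf{M}$ is the symmetric $\binom{n}{\ell}\times\binom{n}{\ell}$ matrix indexed by subsets $S,T\subseteq[n]$ of size $\ell$ with $\mathbf{M}_{S,T} = \mathbf{Y}_{S\triangle T}$ if $|S \triangle T| = p$ and $0$ otherwise ($\triangle$ is symmetric difference). $\lambda_{\max}$ is the largest eigenvalue. A test $f$ achieves strong detection if $\mathbb{P}_\lambda(f(\mathbf{Y})=1)\to1$ and $\mathbb{P}_0(f(\mathbf{Y})=0)\to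 1$ as $n\to\infty$. *)

theory Defs
  imports "HOL-Probability.Probability"
begin

definition ksets :: "nat \<Rightarrow> nat \<Rightarrow> nat set set" where
  "ksets n k = {E. E \<subseteq> {..<n} \<and> card E = k}"

definition signs :: "nat \<Rightarrow> (nat \<Rightarrow> real) set" where
  "signs n = PiE {..<n} (\<lambda>_. {-1, 1})"

definition sign_law :: "nat \<Rightarrow> (nat \<Rightarrow> real) measure" where
  "sign_law n = uniform_count_measure (signs n)"

definition std_gaussian :: "real measure" where
  "std_gaussian = density lborel std_normal_density"

text \<open>Noise: independent N(0,1) entries G_E indexed by the p-subsets E of [n]
  (these are the distinct-index entries of the symmetrized Gaussian tensor G).\<close>
definition noise_law :: "nat \<Rightarrow> nat \<Rightarrow> (nat set \<Rightarrow> real) measure" where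
  "noise_law n p = PiM (ksets n p) (\<lambda>_. std_gaussian)"

definition spiked_law :: "nat \<Rightarrow> nat \<Rightarrow> real \<Rightarrow> (nat set \<Rightarrow> real) measure" where
  "spiked_law n p lam =
     distr (sign_law n \<Otimes>\<^sub>M noise_law n p) (PiM (ksets n p) (\<lambda>_. lborel))
       (\<lambda>(x, G). \<lambda>E\<in>ksets n p. lam * (\<Prod>i\<in>E. x i) + G E)"

definition symdiff_matrix :: "nat \<Rightarrow> (nat set \<Rightarrow> real) \<Rightarrow> nat set \<Rightarrow> nat set \<Rightarrow> real" where
  "symdiff_matrix p Y S T =
     (let D = (S - T) \<union> (T - S) in if card D = p then Y D else 0)"

definition eigenvalues_on :: "'i set \<Rightarrow> ('i \<Rightarrow> 'i \<Rightarrow> real) \<Rightarrow> real set" where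
  "eigenvalues_on I A =
     {mu. \<exists>v. (\<exists>s\<in>I. v s \<noteq> 0) \<and> (\<forall>s\<in>I. (\<Sum>t\<in>I. A s t * v t) = mu * v s)}"

definition lambda_max :: "'i set \<Rightarrow> ('i \<Rightarrow> 'i \<Rightarrow> real) \<Rightarrow> real" where
  "lambda_max I A = Max (eigenvalues_on I A)"

definition lmax_M :: "nat \<Rightarrow> nat \<Rightarrow> nat \<Rightarrow> (nat set \<Rightarrow> real) \<Rightarrow> real" where
  "lmax_M n p l Y = lambda_max (ksets n l) (symdiff_matrix p Y)"

definition d_ell :: "nat \<Rightarrow> nat \<Rightarrow> nat \<Rightarrow> real" where
  "d_ell n p l = real ((n - l) choose (p div 2)) * real (l choose (p div 2))"

definition strong_detection ::
  "(nat \<Rightarrow> 'a measure) \<Rightarrow> (nat \<Rightarrow> 'a measure) \<Rightarrow> (nat \<Rightarrow> 'a \<Rightarrow> nat) \<Rightarrow> bool" where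
  "strong_detection P0 P1 f \<longleftrightarrow>
     ((\<lambda>n. measure (P1 n) {Y \<in> space (P1 n). f n Y = 1}) \<longlonglongrightarrow> 1) \<and>
     ((\<lambda>n. measure (P0 n) {Y \<in> space (P0 n). f n Y = 0}) \<longlonglongrightarrow> 1)"

end

theory Submission
  imports Defs "HOL-Real_Asymp.Real_Asymp"
begin

text \<open>The upper tail under the null law is obtained from moments, without any matrix exponential.
  An eigenvalue \<open>\<mu>\<close> of the symmetric matrix \<open>M\<close> satisfies \<open>\<mu>\<close>^(2q) \<open>\<le>\<close> tr M^(2q). The trace is a sum
  over closed walks of length 2q in the slice of \<open>l\<close>-subsets, and Wick's formula turns the expectation of
  each term into a count of the pairings of {0, ..., 2q - 1} that match equal increments. As every
  \<open>l\<close>-subset has exactly \<open>d\<close> neighbours, at most d^q walks from a given subset are compatible with a given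
  pairing, hence E tr M^(2q) \<open>\<le>\<close> (2q - 1)!! d^q (n choose l). Applying Markov's inequality for each q and
  summing against \<open>\<theta>\<close>^(2q) / (2q)! gives P(lmax \<open>\<ge>\<close> t) cosh (\<open>\<theta>\<close> t) \<open>\<le>\<close> (n choose l) exp (\<open>\<theta>\<close>^2 d / 2).

  Under the planted law, the Rayleigh quotient of the vector with entries \<open>\<Prod>i\<in>S. x i\<close> is \<open>lam * d\<close> plus a
  centred Gaussian of variance at most \<open>d\<close>.\<close>

section \<open>Extreme eigenvalues of symmetric matrices\<close>

definition mat_vec :: "'i set \<Rightarrow> ('i \<Rightarrow> 'i \<Rightarrow> real) \<Rightarrow> ('i \<Rightarrow> real) \<Rightarrow> 'i \<Rightarrow> real" where
  "mat_vec I A v s = (\<Sum>t\<in>I. A s t * v t)"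

definition inner_on :: "'i set \<Rightarrow> ('i \<Rightarrow> real) \<Rightarrow> ('i \<Rightarrow> real) \<Rightarrow> real" where
  "inner_on I v w = (\<Sum>s\<in>I. v s * w s)"

definition symmetric_on :: "'i set \<Rightarrow> ('i \<Rightarrow> 'i \<Rightarrow> real) \<Rightarrow> bool" where
  "symmetric_on I A \<longleftrightarrow> (\<forall>s\<in>I. \<forall>t\<in>I. A s t = A t s)"

lemma inner_on_commute: "inner_on I v w = inner_on I w v"
  by (simp add: inner_on_def mult.commute)

lemma inner_on_nonneg: "0 \<le> inner_on I v v"
  by (simp add: inner_on_def sum_nonneg)

lemma inner_on_pos:
  assumes "finite I" "s \<in> I" "v s \<noteq> 0"
  shows "0 < inner_on I v v"
  unfolding inner_on_def using assms by (intro sum_pos2[of _ s]) (auto simp: zero_less_mult_iff)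

lemma inner_on_add_right: "inner_on I v (\<lambda>s. x s + y s) = inner_on I v x + inner_on I v y"
  by (simp add: inner_on_def algebra_simps sum.distrib)

lemma inner_on_scale_right: "inner_on I v (\<lambda>s. c * x s) = c * inner_on I v x"
  by (simp add: inner_on_def algebra_simps sum_distrib_left)

lemma inner_on_add_left: "inner_on I (\<lambda>s. x s + y s) v = inner_on I x v + inner_on I y v"
  by (simp add: inner_on_def algebra_simps sum.distrib)

lemma inner_on_scale_left: "inner_on I (\<lambda>s. c * x s) v = c * inner_on I x v"
  by (simp add: inner_on_def algebra_simps sum_distrib_left)

lemma mat_vec_add: "mat_vec I A (\<lambda>s. x s + y s) = (\<lambda>s. mat_vec I A x s + mat_vec I A y s)"
  by (simp add: mat_vec_def fun_eq_iff algebra_simps sum.distrib)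

lemma mat_vec_scale: "mat_vec I A (\<lambda>s. c * x s) = (\<lambda>s. c * mat_vec I A x s)"
  by (simp add: mat_vec_def fun_eq_iff algebra_simps sum_distrib_left)

lemma inner_on_mat_vec_symmetric:
  assumes "symmetric_on I A"
  shows "inner_on I v (mat_vec I A w) = inner_on I w (mat_vec I A v)"
proof -
  have "inner_on I v (mat_vec I A w) = (\<Sum>s\<in>I. \<Sum>t\<in>I. v s * (A s t * w t))"
    by (simp add: inner_on_def mat_vec_def sum_distrib_left)
  also have "\<dots> = (\<Sum>t\<in>I. \<Sum>s\<in>I. v s * (A s t * w t))"
    by (rule sum.swap)
  also have "\<dots> = (\<Sum>t\<in>I. \<Sum>s\<in>I. w t * (A t s * v s))"
    using assms by (intro sum.cong refl) (auto simp: symmetric_on_def)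
  also have "\<dots> = inner_on I w (mat_vec I A v)"
    by (simp add: inner_on_def mat_vec_def sum_distrib_left)
  finally show ?thesis .
qed

section \<open>Variational description of the top eigenvalue\<close>

lemma continuous_on_inner_on_mat_vec:
  "continuous_on UNIV (\<lambda>v::'i \<Rightarrow> real. inner_on I v (mat_vec I A v))"
  unfolding inner_on_def mat_vec_def by (intro continuous_intros continuous_on_product_coordinates)

lemma continuous_on_inner_on: "continuous_on UNIV (\<lambda>v::'i \<Rightarrow> real. inner_on I v v)"
  unfolding inner_on_def by (intro continuous_intros continuous_on_product_coordinates)

text \<open>Vectors are total functions under the product topology, so the condition that
  \<open>v\<close> vanishes off \<open>I\<close> is what gives compactness: the set is a closed part
  of a product of intervals and singletons, compact by Tychonoff.\<close>

lemma compact_unit_sphere_on: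
  assumes "finite I"
  shows "compact {v::'i \<Rightarrow> real. (\<forall>s. s \<notin> I \<longrightarrow> v s = 0) \<and> inner_on I v v = 1}"
proof -
  define B :: "('i \<Rightarrow> real) set" where "B = PiE UNIV (\<lambda>s. if s \<in> I then {-1..1} else {0})"
  have "compact B"
    using compactin_PiE[of "\<lambda>_. euclidean" "UNIV :: 'i set" "\<lambda>s. if s \<in> I then {-1..1::real} else {0}"]
    by (simp add: B_def euclidean_product_topology)
  moreover have "closed {v::'i \<Rightarrow> real. inner_on I v v = 1}"
    by (intro closed_Collect_eq continuous_on_inner_on continuous_on_const)
  moreover have "{v::'i \<Rightarrow> real. (\<forall>s. s \<notin> I \<longrightarrow> v s = 0) \<and> inner_on I v v = 1} = B \<inter> {v. inner_on I v v = 1}"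
  proof -
    have "v s \<in> {-1..1}" if "inner_on I v v = 1" "s \<in> I" for v s
    proof -
      have "v s * v s \<le> inner_on I v v"
        unfolding inner_on_def using assms that by (intro member_le_sum) auto
      then have "\<bar>v s\<bar> \<le> 1"
        using that by (simp add: abs_le_square_iff[of "v s" 1, simplified] power2_eq_square)
      then show ?thesis by auto
    qed
    then show ?thesis by (fastforce simp: B_def PiE_iff split: if_splits)
  qed
  ultimately show ?thesis by (simp add: compact_Int_closed)
qed

text \<open>One object supplies both claims: a maximiser of the quadratic form on the compact unit
  sphere. Homogeneity extends its bound to all vectors, and stationarity makes it an
  eigenvector.\<close>

lemma rayleigh_max_eigenvalue:
  assumes fin: "finite I" and ne: "I \<noteq> {}" and sym: "symmetric_on I A"
  shows "\<exists>mu\<in>eigenvalues_on I A. \<forall>v. inner_on I v (mat_vec I A v) \<le> mu * inner_on I v v"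
proof -
  let ?Q = "\<lambda>v. inner_on I v (mat_vec I A v)"
  define K where "K = {v::'a \<Rightarrow> real. (\<forall>s. s \<notin> I \<longrightarrow> v s = 0) \<and> inner_on I v v = 1}"
  obtain i where i: "i \<in> I" using ne by blast
  have "(\<lambda>s. if s = i then 1 else 0) \<in> K"
    using i fin by (auto simp: K_def inner_on_def if_distrib cong: if_cong)
  then have "K \<noteq> {}" by blast
  moreover have "compact K"
    unfolding K_def using fin by (rule compact_unit_sphere_on)
  ultimately obtain u where u: "u \<in> K" "\<And>v. v \<in> K \<Longrightarrow> ?Q v \<le> ?Q u"
    using continuous_attains_sup[of K ?Q] continuous_on_subset[OF continuous_on_inner_on_mat_vec, of K I A]
    by blast
  define mu where "mu = ?Q u"
  have le: "?Q v \<le> mu * inner_on I v v" for v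
  proof (cases "inner_on I v v = 0")
    case True
    then have "v s = 0" if "s \<in> I" for s
      using inner_on_pos[OF fin that, of v] by fastforce
    then have "?Q v = 0" by (simp add: inner_on_def)
    with True show ?thesis by simp
  next
    case False
    define r where "r = inner_on I v v"
    have r: "r > 0" using False inner_on_nonneg[of I v] by (simp add: r_def)
    \<comment> \<open>Besides normalising, \<open>w\<close> is set to zero off \<open>I\<close> so
      that it belongs to \<open>K\<close>; \<open>cong\<close> records that neither form sees this
      change.\<close>
    define w where "w = (\<lambda>s. (1 / sqrt r) * (if s \<in> I then v s else 0))"
    have cong: "inner_on I w (mat_vec I A w) = inner_on I (\<lambda>s. 1 / sqrt r * v s) (mat_vec I A (\<lambda>s. 1 / sqrt r * v s))"
      "inner_on I w w = inner_on I (\<lambda>s. 1 / sqrt r * v s) (\<lambda>s. 1 / sqrt r * v s)"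
      by (auto simp: w_def inner_on_def mat_vec_def intro!: sum.cong)
    have "inner_on I w w = 1"
      using r unfolding cong inner_on_scale_left inner_on_scale_right by (simp add: r_def[symmetric] field_simps)
    then have "w \<in> K" by (simp add: K_def w_def)
    then have "?Q w \<le> mu" using u(2) mu_def by blast
    moreover have "?Q w = ?Q v / r"
      using r unfolding cong mat_vec_scale inner_on_scale_left inner_on_scale_right by (simp add: field_simps)
    ultimately show ?thesis using r by (simp add: r_def[symmetric] field_simps)
  qed
  define d where "d = (\<lambda>s. mat_vec I A u s + (- mu) * u s)"
  define R where "R = inner_on I d d"
  have uu: "inner_on I u u = 1" using u(1) by (simp add: K_def)
  \<comment> \<open>first variation of the Rayleigh quotient at its maximiser in the direction of the residual\<close>
  have "R \<le> 0"
  proof (rule ccontr)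
    assume "\<not> R \<le> 0"
    then have R: "R > 0" by simp
    define c where "c = ?Q d - mu * inner_on I d d"
    \<comment> \<open>Moving from \<open>u\<close> to \<open>u + t * d\<close> changes the form
      minus \<open>mu\<close> times the squared norm by \<open>2 * t * R + t\<^sup>2 * c\<close>.
      This \<open>t\<close> keeps \<open>t * \<bar>c\<bar>\<close> at most \<open>R\<close>, so the
      linear term wins; the \<open>+ 1\<close> covers \<open>c = 0\<close>.\<close>
    define t where "t = R / (\<bar>c\<bar> + 1)"
    have t: "t > 0" using R by (simp add: t_def add_nonneg_pos)
    have "?Q (\<lambda>s. u s + t * d s) \<le> mu * inner_on I (\<lambda>s. u s + t * d s) (\<lambda>s. u s + t * d s)"
      by (rule le)
    moreover have "?Q (\<lambda>s. u s + t * d s) = mu + 2 * t * inner_on I d (mat_vec I A u) + t\<^sup>2 * ?Q d"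
      unfolding mat_vec_add mat_vec_scale inner_on_add_left inner_on_add_right inner_on_scale_left inner_on_scale_right
      using inner_on_mat_vec_symmetric[OF sym, of u d] by (simp add: mu_def algebra_simps power2_eq_square)
    moreover have "inner_on I (\<lambda>s. u s + t * d s) (\<lambda>s. u s + t * d s) = 1 + 2 * t * inner_on I d u + t\<^sup>2 * inner_on I d d"
      unfolding inner_on_add_left inner_on_add_right inner_on_scale_left inner_on_scale_right
      using inner_on_commute[of I u d] uu by (simp add: algebra_simps power2_eq_square)
    moreover have "inner_on I d (mat_vec I A u) = R + mu * inner_on I d u"
      unfolding R_def by (subst (3) d_def, unfold inner_on_add_right inner_on_scale_right) simp
    ultimately have "2 * t * R + t\<^sup>2 * c \<le> 0"
      by (simp add: c_def algebra_simps)
    then have "t * (2 * R + t * c) \<le> 0" by (simp add: algebra_simps power2_eq_square)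
    then have "2 * R + t * c \<le> 0" using t by (simp add: mult_le_0_iff)
    moreover have "t * (\<bar>c\<bar> + 1) = R" by (simp add: t_def)
    then have "t * \<bar>c\<bar> \<le> R" using t by (simp add: algebra_simps)
    moreover have "- (t * \<bar>c\<bar>) \<le> t * c" using t by (simp add: abs_if)
    ultimately show False using R by linarith
  qed
  then have "d s = 0" if "s \<in> I" for s
    using inner_on_pos[OF fin that, of d] by (fastforce simp: R_def)
  then have "\<forall>s\<in>I. (\<Sum>t\<in>I. A s t * u t) = mu * u s"
    by (simp add: d_def mat_vec_def)
  moreover have "\<exists>s\<in>I. u s \<noteq> 0"
    using uu by (metis (no_types, lifting) inner_on_def mult_zero_left sum.neutral zero_neq_one)
  ultimately show ?thesis using le by (auto simp: eigenvalues_on_def)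
qed

lemma eigenvalues_on_orthogonal:
  assumes "symmetric_on I A"
    and "\<forall>s\<in>I. (\<Sum>t\<in>I. A s t * v t) = mu * v s" "\<forall>s\<in>I. (\<Sum>t\<in>I. A s t * w t) = nu * w s"
    and "mu \<noteq> nu"
  shows "inner_on I v w = 0"
proof -
  have "inner_on I v (mat_vec I A w) = nu * inner_on I v w"
    using assms(3) by (simp add: inner_on_def mat_vec_def sum_distrib_left mult_ac)
  moreover have "inner_on I w (mat_vec I A v) = mu * inner_on I v w"
    using assms(2) by (simp add: inner_on_def mat_vec_def sum_distrib_left mult_ac)
  ultimately have "(mu - nu) * inner_on I v w = 0"
    using inner_on_mat_vec_symmetric[OF assms(1), of v w] by (simp add: algebra_simps)
  with assms(4) show ?thesis by simp
qed

text \<open>Bessel's inequality for each coordinate vector, summed over the coordinates: the squared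
  norms add up to \<open>card F\<close>, and each coordinate contributes at most 1.\<close>

lemma card_orthonormal_family_le:
  assumes fin: "finite I" "finite F"
    and orth: "\<And>mu nu. mu \<in> F \<Longrightarrow> nu \<in> F \<Longrightarrow> inner_on I (e mu) (e nu) = (if mu = nu then 1 else 0)"
  shows "card F \<le> card I"
proof -
  have bessel: "(\<Sum>mu\<in>F. (e mu s)\<^sup>2) \<le> 1" if s: "s \<in> I" for s
  proof -
    define w where "w = (\<lambda>t. if t = s then 1 else 0::real)"
    define z where "z = (\<lambda>t. \<Sum>mu\<in>F. e mu s * e mu t)"
    have zz: "inner_on I z z = (\<Sum>mu\<in>F. (e mu s)\<^sup>2)"
    proof -
      have "inner_on I z z = (\<Sum>t\<in>I. \<Sum>mu\<in>F. \<Sum>nu\<in>F. e mu s * e nu s * (e mu t * e nu t))"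
        by (simp add: inner_on_def z_def sum_product mult_ac)
      also have "\<dots> = (\<Sum>mu\<in>F. \<Sum>t\<in>I. \<Sum>nu\<in>F. e mu s * e nu s * (e mu t * e nu t))"
        by (rule sum.swap)
      also have "\<dots> = (\<Sum>mu\<in>F. \<Sum>nu\<in>F. \<Sum>t\<in>I. e mu s * e nu s * (e mu t * e nu t))"
        by (intro sum.cong refl sum.swap)
      also have "\<dots> = (\<Sum>mu\<in>F. \<Sum>nu\<in>F. e mu s * e nu s * inner_on I (e mu) (e nu))"
        by (simp add: inner_on_def sum_distrib_left)
      also have "\<dots> = (\<Sum>mu\<in>F. \<Sum>nu\<in>F. if mu = nu then e mu s * e nu s else 0)"
        by (intro sum.cong refl) (auto simp: orth)
      finally show ?thesis using fin(2) by (simp add: power2_eq_square)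
    qed
    have wx: "inner_on I w x = x s" for x
      using fin(1) s by (simp add: inner_on_def w_def if_distrib if_distribR cong: if_cong)
    \<comment> \<open>\<open>z\<close> is the projection of the coordinate vector \<open>w\<close>
      onto the span of the family, and this is the squared norm of the residual.\<close>
    have "0 \<le> inner_on I (\<lambda>t. w t + (-1) * z t) (\<lambda>t. w t + (-1) * z t)" by (rule inner_on_nonneg)
    also have "\<dots> = inner_on I w w - 2 * inner_on I w z + inner_on I z z"
      unfolding inner_on_add_left inner_on_add_right inner_on_scale_left inner_on_scale_right
      using inner_on_commute[of I w z] by simp
    also have "\<dots> = 1 - (\<Sum>mu\<in>F. (e mu s)\<^sup>2)"
      unfolding zz wx by (simp add: w_def z_def power2_eq_square)
    finally show ?thesis by simp
  qed
  have "real (card F) = (\<Sum>mu\<in>F. inner_on I (e mu) (e mu))" by (simp add: orth)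
  also have "\<dots> = (\<Sum>s\<in>I. \<Sum>mu\<in>F. (e mu s)\<^sup>2)"
    unfolding inner_on_def by (subst sum.swap) (simp add: power2_eq_square)
  also have "\<dots> \<le> (\<Sum>s\<in>I. 1)" by (intro sum_mono bessel)
  finally show ?thesis by simp
qed

text \<open>Makes the \<open>Max\<close> in \<open>lambda_max\<close> meaningful. Normalised
  eigenvectors of distinct eigenvalues are orthonormal, so every finite set of eigenvalues has at
  most \<open>card I\<close> members.\<close>

lemma finite_eigenvalues_on:
  assumes fin: "finite I" and sym: "symmetric_on I A"
  shows "finite (eigenvalues_on I A)"
proof -
  have "card F \<le> card I" if F: "F \<subseteq> eigenvalues_on I A" "finite F" for F
  proof -
    have "\<forall>mu\<in>F. \<exists>v. (\<exists>s\<in>I. v s \<noteq> 0) \<and> (\<forall>s\<in>I. (\<Sum>t\<in>I. A s t * v t) = mu * v s)"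
      using F(1) by (auto simp: eigenvalues_on_def)
    then obtain u where u: "\<And>mu. mu \<in> F \<Longrightarrow> \<exists>s\<in>I. u mu s \<noteq> 0"
      "\<And>mu. mu \<in> F \<Longrightarrow> \<forall>s\<in>I. (\<Sum>t\<in>I. A s t * u mu t) = mu * u mu s"
      by metis
    define e where "e = (\<lambda>mu s. (1 / sqrt (inner_on I (u mu) (u mu))) * u mu s)"
    have "inner_on I (e mu) (e nu) = (if mu = nu then 1 else 0)" if "mu \<in> F" "nu \<in> F" for mu nu
    proof (cases "mu = nu")
      case True
      have "inner_on I (u mu) (u mu) > 0"
        using u(1)[OF \<open>mu \<in> F\<close>] inner_on_pos[OF fin] by blast
      then show ?thesis unfolding e_def inner_on_scale_left inner_on_scale_right using True
        by (simp add: field_simps)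
    next
      case False
      then show ?thesis unfolding e_def inner_on_scale_left inner_on_scale_right
        using eigenvalues_on_orthogonal[OF sym u(2)[OF that(1)] u(2)[OF that(2)] False] by simp
    qed
    then show ?thesis by (rule card_orthonormal_family_le[OF fin F(2)])
  qed
  then show ?thesis by (metis finite_if_finite_subsets_card_bdd)
qed

lemma lambda_max_eigenvalue:
  assumes "finite I" "I \<noteq> {}" "symmetric_on I A"
  shows "lambda_max I A \<in> eigenvalues_on I A"
  unfolding lambda_max_def
  using finite_eigenvalues_on[OF assms(1,3)] rayleigh_max_eigenvalue[OF assms] by (intro Max_in) auto

lemma rayleigh_le_lambda_max:
  assumes "finite I" "I \<noteq> {}" "symmetric_on I A"
  shows "inner_on I v (mat_vec I A v) \<le> lambda_max I A * inner_on I v v"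
proof -
  obtain mu where mu: "mu \<in> eigenvalues_on I A" "inner_on I v (mat_vec I A v) \<le> mu * inner_on I v v"
    using rayleigh_max_eigenvalue[OF assms] by blast
  have "mu \<le> lambda_max I A"
    unfolding lambda_max_def using finite_eigenvalues_on[OF assms(1,3)] mu(1) by (intro Max_ge)
  then have "mu * inner_on I v v \<le> lambda_max I A * inner_on I v v"
    by (intro mult_right_mono inner_on_nonneg)
  with mu(2) show ?thesis by linarith
qed

text \<open>Serves measurability: the event on the left becomes a countable union of events about
  single quadratic forms. The strict inequality survives the approximation of a top eigenvector by
  rational vectors, and \<open>PiE\<close> keeps the index set of the union countable.\<close>

lemma lambda_max_gt_iff_rational:
  assumes fin: "finite I" and ne: "I \<noteq> {}" and sym: "symmetric_on I A"
  shows "lambda_max I A > c \<longleftrightarrow> (\<exists>v\<in>PiE I (\<lambda>_. \<rat>). inner_on I v (mat_vec I A v) > c * inner_on I v v)"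
proof
  assume gt: "lambda_max I A > c"
  obtain v where v: "\<exists>s\<in>I. v s \<noteq> 0" "\<forall>s\<in>I. (\<Sum>t\<in>I. A s t * v t) = lambda_max I A * v s"
    using lambda_max_eigenvalue[OF assms] by (auto simp: eigenvalues_on_def)
  have "inner_on I v (mat_vec I A v) = lambda_max I A * inner_on I v v"
    using v(2) by (simp add: inner_on_def mat_vec_def sum_distrib_left mult_ac)
  moreover have "inner_on I v v > 0" using v(1) inner_on_pos[OF fin] by blast
  ultimately have pos: "inner_on I v (mat_vec I A v) - c * inner_on I v v > 0"
    using gt by simp
  have "\<exists>f. (\<forall>n. f n \<in> \<rat>) \<and> f \<longlonglongrightarrow> v s" for s
    using closure_sequential[of "v s" \<rat>] Rats_closure_real by auto
  then obtain f where f: "\<And>s n. f s n \<in> \<rat>" "\<And>s. f s \<longlonglongrightarrow> v s" by metis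
  have "(\<lambda>n. inner_on I (\<lambda>s. f s n) (mat_vec I A (\<lambda>s. f s n)) - c * inner_on I (\<lambda>s. f s n) (\<lambda>s. f s n))
     \<longlonglongrightarrow> inner_on I v (mat_vec I A v) - c * inner_on I v v"
    unfolding inner_on_def mat_vec_def by (intro tendsto_intros f)
  from order_tendstoD(1)[OF this pos] obtain n where
    "inner_on I (\<lambda>s. f s n) (mat_vec I A (\<lambda>s. f s n)) - c * inner_on I (\<lambda>s. f s n) (\<lambda>s. f s n) > 0"
    by (auto simp: eventually_sequentially)
  then have "inner_on I (\<lambda>s\<in>I. f s n) (mat_vec I A (\<lambda>s\<in>I. f s n)) > c * inner_on I (\<lambda>s\<in>I. f s n) (\<lambda>s\<in>I. f s n)"
    by (simp add: inner_on_def mat_vec_def)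
  moreover have "(\<lambda>s\<in>I. f s n) \<in> PiE I (\<lambda>_. \<rat>)" using f(1) by auto
  ultimately show "\<exists>v\<in>PiE I (\<lambda>_. \<rat>). inner_on I v (mat_vec I A v) > c * inner_on I v v" by blast
next
  assume "\<exists>v\<in>PiE I (\<lambda>_. \<rat>). inner_on I v (mat_vec I A v) > c * inner_on I v v"
  then obtain v where v: "inner_on I v (mat_vec I A v) > c * inner_on I v v" by blast
  show "lambda_max I A > c"
  proof (rule ccontr)
    assume "\<not> ?thesis"
    then have "lambda_max I A * inner_on I v v \<le> c * inner_on I v v"
      by (intro mult_right_mono inner_on_nonneg) simp
    with rayleigh_le_lambda_max[OF assms, of v] v show False by linarith
  qed
qed

section \<open>Powers of a symmetric matrix and their trace\<close>

primrec mat_pow :: "'i set \<Rightarrow> ('i \<Rightarrow> 'i \<Rightarrow> real) \<Rightarrow> nat \<Rightarrow> 'i \<Rightarrow> 'i \<Rightarrow> real" where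
  "mat_pow I A 0 s t = (if s = t then 1 else 0)"
| "mat_pow I A (Suc k) s t = (\<Sum>u\<in>I. mat_pow I A k s u * A u t)"

lemma mat_pow_add:
  assumes "finite I" "t \<in> I"
  shows "mat_pow I A (j + k) s t = (\<Sum>u\<in>I. mat_pow I A j s u * mat_pow I A k u t)"
  using assms(2)
proof (induction k arbitrary: t)
  case 0
  then show ?case using assms(1) by (simp add: if_distrib cong: if_cong)
next
  case (Suc k)
  have "mat_pow I A (j + Suc k) s t = (\<Sum>r\<in>I. (\<Sum>u\<in>I. mat_pow I A j s u * mat_pow I A k u r) * A r t)"
    using Suc.IH by simp
  also have "\<dots> = (\<Sum>r\<in>I. \<Sum>u\<in>I. mat_pow I A j s u * (mat_pow I A k u r * A r t))"
    by (simp add: sum_distrib_right mult.assoc)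
  also have "\<dots> = (\<Sum>u\<in>I. \<Sum>r\<in>I. mat_pow I A j s u * (mat_pow I A k u r * A r t))"
    by (rule sum.swap)
  finally show ?case by (simp add: sum_distrib_left)
qed

lemma mat_pow_symmetric:
  assumes "finite I" "symmetric_on I A"
  shows "s \<in> I \<Longrightarrow> t \<in> I \<Longrightarrow> mat_pow I A k s t = mat_pow I A k t s"
proof (induction k arbitrary: s t)
  case (Suc k)
  have one: "mat_pow I A 1 u r = A u r" if "u \<in> I" for u r
    using assms(1) that by (simp add: if_distribR if_distrib cong: if_cong)
  have "mat_pow I A (Suc k) s t = (\<Sum>u\<in>I. mat_pow I A 1 t u * mat_pow I A k u s)"
    using Suc assms(2) one by (auto simp: symmetric_on_def mult.commute intro!: sum.cong simp del: One_nat_def)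
  also have "\<dots> = mat_pow I A (1 + k) t s"
    using mat_pow_add[OF assms(1) Suc.prems(1), of A 1 k t] by simp
  finally show ?case by simp
qed simp

lemma mat_pow_eigenvector:
  assumes "finite I" and ev: "\<forall>s\<in>I. (\<Sum>t\<in>I. A s t * v t) = mu * v s" and "s \<in> I"
  shows "(\<Sum>t\<in>I. mat_pow I A k s t * v t) = mu ^ k * v s"
proof (induction k)
  case 0
  then show ?case using assms by (simp add: if_distribR if_distrib cong: if_cong)
next
  case (Suc k)
  have "(\<Sum>t\<in>I. mat_pow I A (Suc k) s t * v t) = (\<Sum>t\<in>I. \<Sum>u\<in>I. mat_pow I A k s u * (A u t * v t))"
    by (simp add: sum_distrib_right mult.assoc)
  also have "\<dots> = (\<Sum>u\<in>I. \<Sum>t\<in>I. mat_pow I A k s u * (A u t * v t))" by (rule sum.swap)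
  also have "\<dots> = (\<Sum>u\<in>I. mat_pow I A k s u * (mu * v u))"
    using ev by (simp add: sum_distrib_left[symmetric])
  also have "\<dots> = mu * (\<Sum>u\<in>I. mat_pow I A k s u * v u)"
    by (simp add: sum_distrib_left mult_ac)
  finally show ?case using Suc by simp
qed

text \<open>Bounding the operator norm of a power by its Frobenius norm avoids diagonalisation.\<close>

lemma eigenvalue_power_le_trace:
  assumes fin: "finite I" and sym: "symmetric_on I A" and mu: "mu \<in> eigenvalues_on I A"
  shows "mu ^ (2 * q) \<le> (\<Sum>s\<in>I. mat_pow I A (2 * q) s s)"
proof -
  obtain v where v: "\<exists>s\<in>I. v s \<noteq> 0" "\<forall>s\<in>I. (\<Sum>t\<in>I. A s t * v t) = mu * v s"
    using mu by (auto simp: eigenvalues_on_def)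
  have pos: "(\<Sum>t\<in>I. (v t)\<^sup>2) > 0"
    using v(1) inner_on_pos[OF fin] by (force simp: inner_on_def power2_eq_square)
  have "mu ^ (2 * q) * (\<Sum>s\<in>I. (v s)\<^sup>2) = (\<Sum>s\<in>I. (\<Sum>t\<in>I. mat_pow I A q s t * v t)\<^sup>2)"
    using mat_pow_eigenvector[OF fin v(2)]
    by (simp add: sum_distrib_left power_mult_distrib power_mult[symmetric] mult.commute)
  also have "\<dots> \<le> (\<Sum>s\<in>I. (\<Sum>t\<in>I. (mat_pow I A q s t)\<^sup>2) * (\<Sum>t\<in>I. (v t)\<^sup>2))"
    by (intro sum_mono Cauchy_Schwarz_ineq_sum)
  also have "\<dots> = (\<Sum>s\<in>I. \<Sum>t\<in>I. (mat_pow I A q s t)\<^sup>2) * (\<Sum>t\<in>I. (v t)\<^sup>2)"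
    by (simp add: sum_distrib_right)
  finally have "mu ^ (2 * q) \<le> (\<Sum>s\<in>I. \<Sum>t\<in>I. (mat_pow I A q s t)\<^sup>2)"
    using pos by simp
  also have "\<dots> = (\<Sum>s\<in>I. \<Sum>t\<in>I. mat_pow I A q s t * mat_pow I A q t s)"
    using mat_pow_symmetric[OF fin sym] by (intro sum.cong refl) (simp add: power2_eq_square)
  also have "\<dots> = (\<Sum>s\<in>I. mat_pow I A (2 * q) s s)"
    using mat_pow_add[OF fin, of _ A q q] by (simp add: mult_2)
  finally show ?thesis .
qed

section \<open>Gaussian moments and pairings\<close>

definition gauss_moment :: "nat \<Rightarrow> real" where
  "gauss_moment k = (\<integral>x. x ^ k \<partial>std_gaussian)"

lemma sets_std_gaussian [simp, measurable_cong]: "sets std_gaussian = sets borel"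
  by (simp add: std_gaussian_def)

lemma space_std_gaussian [simp]: "space std_gaussian = UNIV"
  by (simp add: std_gaussian_def)

lemma prob_space_std_gaussian: "prob_space std_gaussian"
  unfolding std_gaussian_def by (rule prob_space_normal_density) simp

lemma integrable_std_gaussian_iff:
  assumes [measurable]: "f \<in> borel_measurable borel"
  shows "integrable std_gaussian f \<longleftrightarrow> integrable lborel (\<lambda>x. std_normal_density x * f x)"
  unfolding std_gaussian_def by (subst integrable_density) auto

lemma integral_std_gaussian:
  assumes [measurable]: "f \<in> borel_measurable borel"
  shows "(\<integral>x. f x \<partial>std_gaussian) = (\<integral>x. std_normal_density x * f x \<partial>lborel)"
  unfolding std_gaussian_def by (subst integral_density) auto

lemma integrable_gauss_power: "integrable std_gaussian (\<lambda>x. x ^ k)"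
  by (simp add: integrable_std_gaussian_iff integrable_std_normal_moment)

lemma gauss_moment_even: "gauss_moment (2 * k) = fact (2 * k) / (2 ^ k * fact k)"
  by (simp add: gauss_moment_def integral_std_gaussian integral_std_normal_moment_even)

lemma gauss_moment_odd: "gauss_moment (2 * k + 1) = 0"
  unfolding gauss_moment_def by (subst integral_std_gaussian) (simp_all only: integral_std_normal_moment_odd, simp)

lemma gauss_moment_0 [simp]: "gauss_moment 0 = 1"
  using gauss_moment_even[of 0] by simp

text \<open>The recursion that Gaussian integration by parts would give, read off from the closed
  formulas. At \<open>k = 0\<close> the factor \<open>real k\<close> vanishes, in agreement with the
  zero mean.\<close>

lemma gauss_moment_Suc: "gauss_moment (Suc k) = real k * gauss_moment (k - 1)"
proof (cases "even k")
  case True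
  then obtain j where "k = 2 * j" by blast
  then show ?thesis
    using gauss_moment_odd[of j] gauss_moment_odd[of "j - 1"] by (cases j) auto
next
  case False
  then obtain j where j: "k = 2 * j + 1" by (blast elim: oddE)
  have "gauss_moment (2 * Suc j) = (2 * real j + 1) * gauss_moment (2 * j)"
  proof -
    have "fact (2 * Suc j) = (2 * real j + 2) * ((2 * real j + 1) * fact (2 * j))"
      by (simp add: algebra_simps)
    moreover have "2 ^ Suc j * fact (Suc j) = (2 * real j + 2) * (2 ^ j * fact j)"
      by (simp add: algebra_simps)
    moreover have "c * (a * x) / (c * b) = a * (x / b)" if "c \<noteq> 0" for a b c x :: real
      using that by simp
    moreover have "2 * real j + 2 \<noteq> 0" by linarith
    ultimately show ?thesis
      unfolding gauss_moment_even by presburger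
  qed
  then show ?thesis by (simp add: j)
qed

text \<open>The expectation of the product of the Gaussians labelled \<open>e i\<close> for
  \<open>i\<close> in \<open>I\<close>, with equal labels grouped and different labels independent;
  \<open>integral_noise_monomial\<close> confirms this reading.\<close>

definition wick :: "'b set \<Rightarrow> ('a \<Rightarrow> 'b) \<Rightarrow> 'a set \<Rightarrow> real" where
  "wick K e I = (\<Prod>E\<in>K. gauss_moment (card {i\<in>I. e i = E}))"

text \<open>The index \<open>m\<close> is paired with some \<open>j\<close> of the same label. If
  \<open>J\<close> holds the other indices with label \<open>e m\<close>, the moment of order
  \<open>card J + 1\<close> is \<open>card J\<close> times the moment of order
  \<open>card J - 1\<close>: one copy for each possible partner.\<close>

lemma wick_step:
  assumes fin: "finite K" "finite I" and m: "m \<in> I" and e: "e ` I \<subseteq> K"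
  shows "wick K e I = (\<Sum>j\<in>{j\<in>I - {m}. e j = e m}. wick K e (I - {j, m}))"
proof -
  define J where "J = {j\<in>I - {m}. e j = e m}"
  define rest where "rest = (\<Prod>E\<in>K - {e m}. gauss_moment (card {i\<in>I. e i = E}))"
  have J: "finite J" "m \<notin> J" using fin by (auto simp: J_def)
  have em: "e m \<in> K" using m e by blast
  have "{i\<in>I. e i = e m} = insert m J" using m by (auto simp: J_def)
  then have 1: "wick K e I = gauss_moment (Suc (card J)) * rest"
    unfolding wick_def rest_def using J by (simp add: prod.remove[OF fin(1) em])
  have 2: "wick K e (I - {j, m}) = gauss_moment (card J - 1) * rest" if j: "j \<in> J" for j
  proof -
    have "{i\<in>I - {j, m}. e i = e m} = J - {j}" by (auto simp: J_def)
    then have "card {i\<in>I - {j, m}. e i = e m} = card J - 1" using J j by simp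
    moreover have "{i\<in>I - {j, m}. e i = E} = {i\<in>I. e i = E}" if "E \<noteq> e m" for E
      using that j by (auto simp: J_def)
    then have "(\<Prod>E\<in>K - {e m}. gauss_moment (card {i\<in>I - {j, m}. e i = E})) = rest"
      unfolding rest_def by (intro prod.cong refl) auto
    ultimately show ?thesis
      unfolding wick_def by (simp add: prod.remove[OF fin(1) em])
  qed
  show ?thesis
    unfolding 1 gauss_moment_Suc J_def[symmetric] by (simp add: 2)
qed

text \<open>With the cardinality bound, this says that the pairs partition the index set.\<close>

definition pairing :: "nat set \<Rightarrow> (nat \<times> nat) set \<Rightarrow> bool" where
  "pairing I P \<longleftrightarrow> finite P \<and> 2 * card P \<le> card I \<and> I \<subseteq> fst ` P \<union> snd ` P \<and> (\<forall>(i, j)\<in>P. i < j)"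

definition matches :: "(nat \<Rightarrow> 'b) \<Rightarrow> (nat \<times> nat) set \<Rightarrow> bool" where
  "matches e P \<longleftrightarrow> (\<forall>(i, j)\<in>P. e i = e j)"

lemma pairing_insert:
  assumes P: "pairing (I - {j, m}) P" and I: "finite I" "j \<in> I" "m \<in> I" "j < m"
  shows "pairing I (insert (j, m) P)"
proof -
  have "card (I - {j, m}) + 2 = card I"
  proof -
    have "card (I - {j, m}) = card I - card {j, m}"
      using I by (intro card_Diff_subset) auto
    moreover have "card {j, m} = 2" using I by simp
    moreover have "card {j, m} \<le> card I" using I by (intro card_mono) auto
    ultimately show ?thesis by simp
  qed
  moreover have "card (insert (j, m) P) \<le> card P + 1" by (rule card_insert_le_m1) simp_all
  ultimately show ?thesis using P I unfolding pairing_def by auto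
qed

text \<open>Iterating \<open>wick_step\<close> spreads each term over the pairings it matches. The
  numbers of possible partners, \<open>2 * q - 1\<close>, then \<open>2 * q - 3\<close> and so on,
  multiply to \<open>gauss_moment (2 * q)\<close>, and each complete pairing is matched by at most
  \<open>B\<close> members of \<open>F\<close>. The induction shrinks \<open>F\<close> to the
  members that match the pair just chosen.\<close>

lemma sum_wick_le:
  fixes I :: "nat set" and F :: "'c set" and e :: "'c \<Rightarrow> nat \<Rightarrow> 'b"
  assumes "finite K" "finite I" "card I = 2 * q" "finite F"
    and "\<And>w. w \<in> F \<Longrightarrow> e w ` I \<subseteq> K"
    and "\<And>P. pairing I P \<Longrightarrow> card {w\<in>F. matches (e w) P} \<le> B"
  shows "(\<Sum>w\<in>F. wick K (e w) I) \<le> gauss_moment (2 * q) * real B"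
  using assms(2-)
proof (induction q arbitrary: I F)
  case 0
  then have "I = {}" by simp
  moreover have "card F \<le> B"
    \<comment> \<open>The empty pairing is matched by everything, so the hypothesis bounds the whole
      of \<open>F\<close>.\<close>
    using 0(5)[of "{}"] \<open>I = {}\<close> by (simp add: pairing_def matches_def)
  ultimately show ?case by (simp add: wick_def)
next
  case (Suc q)
  \<comment> \<open>Removing the largest index first makes every new pair \<open>(j, m)\<close>
    increasing, as \<open>pairing\<close> demands.\<close>
  define m where "m = Max I"
  have "I \<noteq> {}" using Suc.prems(2) by auto
  then have m: "m \<in> I" "\<And>j. j \<in> I - {m} \<Longrightarrow> j < m"
    using Max_in[OF Suc.prems(1)] Max_ge[OF Suc.prems(1)] by (auto simp: m_def le_less)
  have card_Im: "card (I - {m}) = 2 * q + 1" using m Suc.prems by simp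
  have "(\<Sum>w\<in>F. wick K (e w) I) = (\<Sum>w\<in>F. \<Sum>j\<in>{j\<in>I - {m}. e w j = e w m}. wick K (e w) (I - {j, m}))"
    using Suc.prems m assms(1) by (intro sum.cong refl wick_step) auto
  also have "\<dots> = (\<Sum>j\<in>I - {m}. \<Sum>w\<in>{w\<in>F. e w j = e w m}. wick K (e w) (I - {j, m}))"
    using Suc.prems by (intro sum.swap_restrict) auto
  also have "\<dots> \<le> (\<Sum>j\<in>I - {m}. gauss_moment (2 * q) * real B)"
  proof (rule sum_mono)
    fix j assume j: "j \<in> I - {m}"
    then have jm: "j < m" using m by blast
    have "card (I - {j, m}) = card (I - {m} - {j})" by (simp add: insert_commute Diff_insert2[symmetric])
    also have "\<dots> = 2 * q" using card_Im j Suc.prems(1) by simp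
    finally have "card (I - {j, m}) = 2 * q" .
    moreover have "card {w \<in> {w\<in>F. e w j = e w m}. matches (e w) P} \<le> B" if "pairing (I - {j, m}) P" for P
    proof -
      have "{w \<in> {w\<in>F. e w j = e w m}. matches (e w) P} = {w\<in>F. matches (e w) (insert (j, m) P)}"
        by (auto simp: matches_def)
      moreover have "pairing I (insert (j, m) P)"
        using pairing_insert that Suc.prems(1) j m(1) jm by blast
      ultimately show ?thesis using Suc.prems(5) by simp
    qed
    ultimately show "(\<Sum>w\<in>{w\<in>F. e w j = e w m}. wick K (e w) (I - {j, m})) \<le> gauss_moment (2 * q) * real B"
      using Suc.prems by (intro Suc.IH) auto
  qed
  also have "\<dots> = gauss_moment (2 * Suc q) * real B"
    using gauss_moment_Suc[of "2 * q + 1"] by (simp add: card_Im)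
  finally show ?case .
qed

section \<open>Walks in a slice of the hypercube\<close>

lemma finite_ksets [simp]: "finite (ksets n k)"
  by (rule finite_subset[of _ "Pow {..<n}"]) (auto simp: ksets_def)

lemma card_ksets: "card (ksets n k) = n choose k"
  using n_subsets[of "{..<n}" k] by (simp add: ksets_def)

definition slice_steps :: "nat \<Rightarrow> nat \<Rightarrow> nat \<Rightarrow> nat set \<Rightarrow> nat set set" where
  "slice_steps n p l S = {E\<in>ksets n p. sym_diff S E \<in> ksets n l}"

lemma finite_slice_steps [simp]: "finite (slice_steps n p l S)"
  by (simp add: slice_steps_def)

text \<open>Passing from \<open>S\<close> to \<open>sym_diff S E\<close> preserves the size exactly
  when \<open>E\<close> removes as many elements as it adds: \<open>h\<close> are chosen inside
  \<open>S\<close> and \<open>h\<close> outside.\<close>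

lemma card_slice_steps:
  assumes S: "S \<in> ksets n l"
  shows "card (slice_steps n (2 * h) l S) = ((n - l) choose h) * (l choose h)"
proof -
  have Sf: "finite S" "S \<subseteq> {..<n}" "card S = l"
    using S by (auto simp: ksets_def intro: finite_subset)
  let ?A = "{X. X \<subseteq> {..<n} - S \<and> card X = h}" and ?B = "{X. X \<subseteq> S \<and> card X = h}"
  have char: "E \<in> slice_steps n (2 * h) l S \<longleftrightarrow> E \<subseteq> {..<n} \<and> card (E - S) = h \<and> card (E \<inter> S) = h" for E
  proof (cases "E \<subseteq> {..<n}")
    case True
    then have fin: "finite E" by (rule finite_subset) simp
    have 1: "card E = card (E - S) + card (E \<inter> S)"
      using fin by (metis Int_Diff_disjoint Int_commute Un_Diff_Int card_Un_disjoint finite_Diff finite_Int inf_commute)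
    have 2: "card S = card (S - E) + card (E \<inter> S)"
      using Sf(1) by (metis Int_Diff_disjoint Un_Diff_Int card_Un_disjoint finite_Diff finite_Int inf_commute)
    have 3: "card (sym_diff S E) = card (S - E) + card (E - S)"
      using fin Sf(1) by (intro card_Un_disjoint) auto
    show ?thesis
      using True Sf 1 2 3 by (auto simp: slice_steps_def ksets_def)
  next
    case False
    then show ?thesis by (simp add: slice_steps_def ksets_def)
  qed
  have "bij_betw (\<lambda>(X, Z). X \<union> Z) (?A \<times> ?B) (slice_steps n (2 * h) l S)"
  proof (rule bij_betw_byWitness[where f' = "\<lambda>E. (E - S, E \<inter> S)"])
    show "\<forall>a\<in>?A \<times> ?B. (\<lambda>E. (E - S, E \<inter> S)) ((\<lambda>(X, Z). X \<union> Z) a) = a" by auto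
    show "\<forall>E\<in>slice_steps n (2 * h) l S. (\<lambda>(X, Z). X \<union> Z) (E - S, E \<inter> S) = E" by auto
    show "(\<lambda>(X, Z). X \<union> Z) ` (?A \<times> ?B) \<subseteq> slice_steps n (2 * h) l S"
    proof safe
      fix X Z assume X: "X \<subseteq> {..<n} - S" "h = card X" and Z: "Z \<subseteq> S" "card Z = card X"
      have "(X \<union> Z) - S = X" "(X \<union> Z) \<inter> S = Z" using X Z by auto
      then show "X \<union> Z \<in> slice_steps n (2 * card X) l S"
        using X Z Sf char[of "X \<union> Z"] by auto
    qed
    show "(\<lambda>E. (E - S, E \<inter> S)) ` slice_steps n (2 * h) l S \<subseteq> ?A \<times> ?B"
      using char by auto
  qed
  then have "card (slice_steps n (2 * h) l S) = card (?A \<times> ?B)" by (simp add: bij_betw_same_card)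
  also have "\<dots> = card ?A * card ?B" by (rule card_cartesian_product)
  also have "\<dots> = ((n - l) choose h) * (l choose h)"
    using Sf by (simp add: n_subsets card_Diff_subset)
  finally show ?thesis .
qed

text \<open>A walk in the slice of \<open>l\<close>-subsets is encoded by the list of its increments.\<close>

definition slice_walks :: "nat \<Rightarrow> nat \<Rightarrow> nat \<Rightarrow> nat set \<Rightarrow> nat \<Rightarrow> nat set list set" where
  "slice_walks n p l S k = {w. length w = k \<and> set w \<subseteq> ksets n p \<and>
     (\<forall>j\<le>k. foldl sym_diff S (take j w) \<in> ksets n l)}"

lemma finite_slice_walks [simp]: "finite (slice_walks n p l S k)"
  by (rule finite_subset[OF _ finite_lists_length_eq[OF finite_ksets[of n p], of k]])
     (auto simp: slice_walks_def)

lemma slice_walks_0: "S \<in> ksets n l \<Longrightarrow> slice_walks n p l S 0 = {[]}"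
  by (auto simp: slice_walks_def)

lemma slice_walks_end: "w \<in> slice_walks n p l S k \<Longrightarrow> foldl sym_diff S w \<in> ksets n l"
  by (auto simp: slice_walks_def)

lemma slice_walks_length: "w \<in> slice_walks n p l S k \<Longrightarrow> length w = k"
  by (simp add: slice_walks_def)

lemma slice_walks_Suc:
  "slice_walks n p l S (Suc k) =
     (\<lambda>(w, E). w @ [E]) ` (SIGMA w:slice_walks n p l S k. slice_steps n p l (foldl sym_diff S w))"
  (is "?L = ?R")
proof
  show "?R \<subseteq> ?L"
    by (auto simp: slice_walks_def slice_steps_def le_Suc_eq)
  show "?L \<subseteq> ?R"
  proof
    fix w assume w: "w \<in> ?L"
    then have "length w = Suc k" by (simp add: slice_walks_def)
    then obtain v E where v: "w = v @ [E]" "length v = k" by (metis length_Suc_conv_rev)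
    have "foldl sym_diff S (take j v) \<in> ksets n l" if "j \<le> k" for j
      using w v that by (auto simp: slice_walks_def dest!: spec[of _ j])
    moreover have "foldl sym_diff S w \<in> ksets n l" using w by (rule slice_walks_end)
    ultimately have "v \<in> slice_walks n p l S k" "E \<in> slice_steps n p l (foldl sym_diff S v)"
      using w v by (auto simp: slice_walks_def slice_steps_def)
    then show "w \<in> ?R" using v by force
  qed
qed

text \<open>Reading a walk from left to right, the first element of each pair is one of \<open>d\<close> possible
  steps, and the second one is then forced.\<close>

lemma card_slice_walks_matching:
  assumes S: "S \<in> ksets n l" and d: "\<And>U. U \<in> ksets n l \<Longrightarrow> card (slice_steps n p l U) = d" "d \<ge> 1"
    and P: "finite P" "\<forall>(i, j)\<in>P. i < j"
  shows "{..<k} \<subseteq> fst ` P \<union> snd ` P \<Longrightarrow>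
    card {w\<in>slice_walks n p l S k. \<forall>(i, j)\<in>P. j < k \<longrightarrow> w ! i = w ! j} \<le> d ^ card {x\<in>P. fst x < k}"
proof (induction k)
  case 0
  then show ?case by (simp add: slice_walks_0[OF S])
next
  case (Suc k)
  define R where "R = {w\<in>slice_walks n p l S k. \<forall>(i, j)\<in>P. j < k \<longrightarrow> w ! i = w ! j}"
  define R' where "R' = {w\<in>slice_walks n p l S (Suc k). \<forall>(i, j)\<in>P. j < Suc k \<longrightarrow> w ! i = w ! j}"
  have finR: "finite R" by (simp add: R_def)
  have IH: "card R \<le> d ^ card {x\<in>P. fst x < k}"
    using Suc by (auto simp: R_def lessThan_Suc)
  have sub: "{x\<in>P. fst x < k} \<subseteq> {x\<in>P. fst x < Suc k}" by auto
  have R'_R: "\<exists>v E. w = v @ [E] \<and> v \<in> R \<and> E \<in> slice_steps n p l (foldl sym_diff S v)" if w: "w \<in> R'" for w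
  proof -
    obtain v E where v: "w = v @ [E]" "v \<in> slice_walks n p l S k" "E \<in> slice_steps n p l (foldl sym_diff S v)"
      using w by (auto simp: R'_def slice_walks_Suc)
    have len: "length v = k" using v(2) by (rule slice_walks_length)
    have "v ! i = v ! j" if "(i, j) \<in> P" "j < k" for i j
    proof -
      have "i < j" using P that by auto
      moreover have "w ! i = w ! j" using w that by (auto simp: R'_def)
      ultimately show ?thesis using v(1) len that by (simp add: nth_append)
    qed
    with v show ?thesis by (auto simp: R_def)
  qed
  have "card R' \<le> d ^ card {x\<in>P. fst x < Suc k}"
  proof (cases "k \<in> snd ` P")
    case True
    then obtain i where i: "(i, k) \<in> P" by force
    then have "i < k" using P by auto
    have "R' \<subseteq> (\<lambda>v. v @ [v ! i]) ` R"
    proof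
      fix w assume w: "w \<in> R'"
      then obtain v E where v: "w = v @ [E]" "v \<in> R" using R'_R by blast
      have "length v = k" using v(2) by (auto simp: R_def intro: slice_walks_length)
      moreover have "w ! i = w ! k" using w i by (auto simp: R'_def)
      ultimately have "E = v ! i" using v(1) \<open>i < k\<close> by (simp add: nth_append)
      then show "w \<in> (\<lambda>v. v @ [v ! i]) ` R" using v by blast
    qed
    then have "card R' \<le> card R" using finR by (rule surj_card_le[rotated])
    also have "\<dots> \<le> d ^ card {x\<in>P. fst x < k}" by (rule IH)
    \<comment> \<open>Here \<open>k\<close> may also be the first element of some pair, so the
      exponent can grow; \<open>d \<ge> 1\<close> absorbs this.\<close>
    also have "\<dots> \<le> d ^ card {x\<in>P. fst x < Suc k}"
      using d(2) P sub by (intro power_increasing card_mono) auto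
    finally show ?thesis .
  next
    case False
    \<comment> \<open>The covering hypothesis leaves only this possibility, and the pair raises the
      exponent by one, which pays for the free choice of the last step.\<close>
    then obtain j where j: "(k, j) \<in> P" using Suc.prems by force
    have "insert (k, j) {x\<in>P. fst x < k} \<subseteq> {x\<in>P. fst x < Suc k}" using j by auto
    then have "card (insert (k, j) {x\<in>P. fst x < k}) \<le> card {x\<in>P. fst x < Suc k}"
      using P by (intro card_mono) auto
    then have cP: "Suc (card {x\<in>P. fst x < k}) \<le> card {x\<in>P. fst x < Suc k}"
      using P by simp
    have "R' \<subseteq> (\<lambda>(v, E). v @ [E]) ` (SIGMA v:R. slice_steps n p l (foldl sym_diff S v))"
      using R'_R by force
    then have "card R' \<le> card (SIGMA v:R. slice_steps n p l (foldl sym_diff S v))"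
      using finR by (intro surj_card_le) auto
    also have "\<dots> = (\<Sum>v\<in>R. card (slice_steps n p l (foldl sym_diff S v)))"
      using finR by (intro card_SigmaI) auto
    also have "\<dots> = (\<Sum>v\<in>R. d)"
      by (intro sum.cong refl d(1)) (auto simp: R_def intro: slice_walks_end)
    also have "\<dots> \<le> d ^ Suc (card {x\<in>P. fst x < k})" using IH by simp
    also have "\<dots> \<le> d ^ card {x\<in>P. fst x < Suc k}"
      using d(2) cP by (intro power_increasing) auto
    finally show ?thesis .
  qed
  then show ?case by (simp add: R'_def)
qed

section \<open>Powers of the symmetric difference matrix as sums over walks\<close>

lemma ksets_sym_diff_subset: "S \<in> ksets n l \<Longrightarrow> T \<in> ksets n l \<Longrightarrow> sym_diff S T \<subseteq> {..<n}"
  by (auto simp: ksets_def)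

lemma symmetric_on_symdiff_matrix: "symmetric_on I (symdiff_matrix p Y)"
  by (simp add: symmetric_on_def symdiff_matrix_def Let_def Un_commute)

text \<open>The map \<open>sym_diff S\<close> is an involution, so the neighbours of
  \<open>S\<close> can be indexed by their increments, which are also the labels of the matrix
  entries.\<close>

lemma sum_symdiff_matrix:
  assumes S: "S \<in> ksets n l"
  shows "(\<Sum>T\<in>ksets n l. symdiff_matrix p Y S T * f T)
       = (\<Sum>E\<in>slice_steps n p l S. Y E * f (sym_diff S E))"
proof -
  have inv: "sym_diff S (sym_diff S T) = T" for T by auto
  have "(\<Sum>T\<in>ksets n l. symdiff_matrix p Y S T * f T)
      = (\<Sum>T\<in>{T\<in>ksets n l. sym_diff S T \<in> ksets n p}. Y (sym_diff S T) * f T)"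
    using S ksets_sym_diff_subset[OF S]
    by (subst sum.inter_filter) (auto simp: symdiff_matrix_def Let_def ksets_def intro!: sum.cong)
  also have "\<dots> = (\<Sum>E\<in>slice_steps n p l S. Y E * f (sym_diff S E))"
    by (rule sum.reindex_bij_witness[where i = "sym_diff S" and j = "sym_diff S"])
       (auto simp: slice_steps_def inv)
  finally show ?thesis .
qed

text \<open>Stated for an arbitrary \<open>f\<close> because the induction applies the hypothesis to
  the function that the last matrix factor produces from \<open>f\<close>. Choosing \<open>f\<close>
  as the indicator of \<open>T\<close> recovers a single entry.\<close>

lemma sum_mat_pow_symdiff_matrix:
  assumes S: "S \<in> ksets n l"
  shows "(\<Sum>T\<in>ksets n l. mat_pow (ksets n l) (symdiff_matrix p Y) k S T * f T)
       = (\<Sum>w\<in>slice_walks n p l S k. (\<Prod>i<k. Y (w ! i)) * f (foldl sym_diff S w))"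
proof (induction k arbitrary: f)
  case 0
  have "(\<Sum>T\<in>ksets n l. mat_pow (ksets n l) (symdiff_matrix p Y) 0 S T * f T) = f S"
    using S by (simp add: if_distribR if_distrib cong: if_cong)
  then show ?case by (simp add: slice_walks_0[OF S])
next
  case (Suc k)
  let ?M = "symdiff_matrix p Y" and ?W = "slice_walks n p l S" and ?e = "foldl sym_diff S"
  have "(\<Sum>T\<in>ksets n l. mat_pow (ksets n l) ?M (Suc k) S T * f T)
      = (\<Sum>T\<in>ksets n l. \<Sum>U\<in>ksets n l. mat_pow (ksets n l) ?M k S U * (?M U T * f T))"
    by (simp add: sum_distrib_right mult.assoc)
  also have "\<dots> = (\<Sum>U\<in>ksets n l. mat_pow (ksets n l) ?M k S U * (\<Sum>T\<in>ksets n l. ?M U T * f T))"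
    by (subst sum.swap) (simp add: sum_distrib_left)
  also have "\<dots> = (\<Sum>w\<in>?W k. (\<Prod>i<k. Y (w ! i)) * (\<Sum>T\<in>ksets n l. ?M (?e w) T * f T))"
    by (rule Suc.IH)
  also have "\<dots> = (\<Sum>w\<in>?W k. \<Sum>E\<in>slice_steps n p l (?e w).
      (\<Prod>i<k. Y (w ! i)) * (Y E * f (sym_diff (?e w) E)))"
    by (intro sum.cong refl) (simp only: sum_symdiff_matrix[OF slice_walks_end] sum_distrib_left)
  also have "\<dots> = (\<Sum>(w, E)\<in>(SIGMA w:?W k. slice_steps n p l (?e w)).
      (\<Prod>i<k. Y (w ! i)) * (Y E * f (sym_diff (?e w) E)))"
    by (rule sum.Sigma) auto
  also have "\<dots> = (\<Sum>(w, E)\<in>(SIGMA w:?W k. slice_steps n p l (?e w)).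
      (\<Prod>i<Suc k. Y ((w @ [E]) ! i)) * f (?e (w @ [E])))"
    by (intro sum.cong refl)
       (auto dest!: slice_walks_length simp: nth_append)
  also have "\<dots> = (\<Sum>w\<in>?W (Suc k). (\<Prod>i<Suc k. Y (w ! i)) * f (?e w))"
    unfolding slice_walks_Suc
    by (subst sum.reindex) (auto simp: inj_on_def intro!: sum.cong)
  finally show ?case .
qed

lemma mat_pow_symdiff_matrix:
  assumes "S \<in> ksets n l" "T \<in> ksets n l"
  shows "mat_pow (ksets n l) (symdiff_matrix p Y) k S T
       = (\<Sum>w\<in>{w\<in>slice_walks n p l S k. foldl sym_diff S w = T}. \<Prod>i<k. Y (w ! i))"
  using sum_mat_pow_symdiff_matrix[OF assms(1), of p Y k "\<lambda>U. if U = T then 1 else 0"] assms(2)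
  by (simp add: sum.inter_filter if_distrib cong: if_cong)

section \<open>The null distribution\<close>

lemma product_sigma_finite_std_gaussian: "product_sigma_finite (\<lambda>_. std_gaussian)"
  by (intro product_sigma_finite.intro prob_space_imp_sigma_finite prob_space_std_gaussian)

lemma prob_space_noise_law: "prob_space (noise_law n p)"
  unfolding noise_law_def by (intro prob_space_PiM prob_space_std_gaussian)

lemma sets_noise_law: "sets (noise_law n p) = sets (PiM (ksets n p) (\<lambda>_. lborel))"
  unfolding noise_law_def by (intro sets_PiM_cong) auto

lemma space_noise_law: "space (noise_law n p) = PiE (ksets n p) (\<lambda>_. UNIV)"
  by (simp add: noise_law_def space_PiM)

lemma
  assumes "\<And>E. E \<in> ksets n p \<Longrightarrow> integrable std_gaussian (f E)"
  shows integrable_noise_prod: "integrable (noise_law n p) (\<lambda>G. \<Prod>E\<in>ksets n p. f E (G E) :: real)"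
    and integral_noise_prod: "(\<integral>G. (\<Prod>E\<in>ksets n p. f E (G E)) \<partial>noise_law n p)
      = (\<Prod>E\<in>ksets n p. \<integral>x. f E x \<partial>std_gaussian)"
proof -
  interpret product_sigma_finite "\<lambda>_::nat set. std_gaussian" by (rule product_sigma_finite_std_gaussian)
  show "integrable (noise_law n p) (\<lambda>G. \<Prod>E\<in>ksets n p. f E (G E))"
    unfolding noise_law_def using assms by (intro product_integrable_prod) auto
  show "(\<integral>G. (\<Prod>E\<in>ksets n p. f E (G E)) \<partial>noise_law n p) = (\<Prod>E\<in>ksets n p. \<integral>x. f E x \<partial>std_gaussian)"
    unfolding noise_law_def using assms by (intro product_integral_prod) auto
qed

lemma
  assumes "finite I" "e ` I \<subseteq> ksets n p"
  shows integrable_noise_monomial: "integrable (noise_law n p) (\<lambda>G. \<Prod>i\<in>I. G (e i))"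
    and integral_noise_monomial: "(\<integral>G. (\<Prod>i\<in>I. G (e i)) \<partial>noise_law n p) = wick (ksets n p) e I"
proof -
  have eq: "(\<Prod>i\<in>I. G (e i)) = (\<Prod>E\<in>ksets n p. G E ^ card {i\<in>I. e i = E})" for G :: "nat set \<Rightarrow> real"
  proof -
    have "(\<Prod>i\<in>I. G (e i)) = (\<Prod>E\<in>ksets n p. \<Prod>i\<in>{i\<in>I. e i = E}. G (e i))"
      by (rule prod.group[OF assms(1) finite_ksets assms(2), symmetric])
    also have "\<dots> = (\<Prod>E\<in>ksets n p. \<Prod>i\<in>{i\<in>I. e i = E}. G E)"
      by (intro prod.cong refl) auto
    finally show ?thesis by simp
  qed
  show "integrable (noise_law n p) (\<lambda>G. \<Prod>i\<in>I. G (e i))"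
    unfolding eq by (intro integrable_noise_prod integrable_gauss_power)
  show "(\<integral>G. (\<Prod>i\<in>I. G (e i)) \<partial>noise_law n p) = wick (ksets n p) e I"
    unfolding eq wick_def gauss_moment_def by (intro integral_noise_prod integrable_gauss_power)
qed

text \<open>A diagonal entry of the power is a sum over closed walks from \<open>S\<close>, and each
  expectation is a \<open>wick\<close> term. So \<open>sum_wick_le\<close> applies with
  \<open>B = d ^ q\<close>, a pairing of \<open>2 * q\<close> indices having at most
  \<open>q\<close> pairs.\<close>

lemma
  assumes S: "S \<in> ksets n l"
    and d: "\<And>U. U \<in> ksets n l \<Longrightarrow> card (slice_steps n p l U) = d" "d \<ge> 1"
  shows integrable_mat_pow_noise:
      "integrable (noise_law n p) (\<lambda>G. mat_pow (ksets n l) (symdiff_matrix p G) (2 * q) S S)"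
    and expectation_mat_pow_noise_le:
      "(\<integral>G. mat_pow (ksets n l) (symdiff_matrix p G) (2 * q) S S \<partial>noise_law n p)
        \<le> gauss_moment (2 * q) * real d ^ q"
proof -
  let ?F = "{w\<in>slice_walks n p l S (2 * q). foldl sym_diff S w = S}"
  have labels: "(!) w ` {..<2 * q} \<subseteq> ksets n p" if "w \<in> ?F" for w
    using that by (auto simp: slice_walks_def)
  have int: "integrable (noise_law n p) (\<lambda>G. \<Prod>i<2 * q. G (w ! i))" if "w \<in> ?F" for w
    using integrable_noise_monomial[OF _ labels[OF that]] by simp
  show "integrable (noise_law n p) (\<lambda>G. mat_pow (ksets n l) (symdiff_matrix p G) (2 * q) S S)"
    unfolding mat_pow_symdiff_matrix[OF S S] by (intro Bochner_Integration.integrable_sum int)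
  have "(\<integral>G. mat_pow (ksets n l) (symdiff_matrix p G) (2 * q) S S \<partial>noise_law n p)
      = (\<Sum>w\<in>?F. \<integral>G. (\<Prod>i<2 * q. G (w ! i)) \<partial>noise_law n p)"
    unfolding mat_pow_symdiff_matrix[OF S S] by (intro Bochner_Integration.integral_sum int)
  also have "\<dots> = (\<Sum>w\<in>?F. wick (ksets n p) ((!) w) {..<2 * q})"
    by (intro sum.cong refl integral_noise_monomial labels) auto
  also have "\<dots> \<le> gauss_moment (2 * q) * real (d ^ q)"
  proof (rule sum_wick_le)
    fix P assume P: "pairing {..<2 * q} P"
    have fP: "finite P" "\<forall>(i, j)\<in>P. i < j" "card P \<le> q" "{..<2 * q} \<subseteq> fst ` P \<union> snd ` P"
      using P by (auto simp: pairing_def)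
    \<comment> \<open>Forgetting that the walk returns to \<open>S\<close> only enlarges the set
      being counted.\<close>
    have "card {w\<in>?F. matches ((!) w) P}
        \<le> card {w\<in>slice_walks n p l S (2 * q). \<forall>(i, j)\<in>P. j < 2 * q \<longrightarrow> w ! i = w ! j}"
      by (intro card_mono) (auto simp: matches_def)
    also have "\<dots> \<le> d ^ card {x\<in>P. fst x < 2 * q}"
      by (rule card_slice_walks_matching[OF S d fP(1,2,4)])
    also have "\<dots> \<le> d ^ card P"
      using d(2) fP(1) by (intro power_increasing card_mono) auto
    also have "\<dots> \<le> d ^ q"
      using d(2) fP(3) by (intro power_increasing) auto
    finally show "card {w\<in>?F. matches ((!) w) P} \<le> d ^ q" .
  qed (use labels in auto)
  finally show "(\<integral>G. mat_pow (ksets n l) (symdiff_matrix p G) (2 * q) S S \<partial>noise_law n p)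
        \<le> gauss_moment (2 * q) * real d ^ q" by simp
qed

section \<open>Measurability and upper tail of the largest eigenvalue\<close>

lemma ksets_nonempty: "l \<le> n \<Longrightarrow> ksets n l \<noteq> {}"
  using card_ksets[of n l] by (metis binomial_eq_0_iff card.empty not_le)

lemma measurable_symdiff_matrix:
  assumes "S \<in> ksets n l" "T \<in> ksets n l"
  shows "(\<lambda>Y. symdiff_matrix p Y S T) \<in> borel_measurable (PiM (ksets n p) (\<lambda>_. lborel))"
proof (cases "card (sym_diff S T) = p")
  case True
  then have "sym_diff S T \<in> ksets n p"
    using ksets_sym_diff_subset[OF assms] by (simp add: ksets_def)
  from measurable_component_singleton[OF this, of "\<lambda>_. lborel"] show ?thesis
    using True by (simp add: symdiff_matrix_def Let_def)
next
  case False
  then show ?thesis by (simp add: symdiff_matrix_def Let_def)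
qed

lemma borel_measurable_lmax_M:
  assumes "l \<le> n"
  shows "lmax_M n p l \<in> borel_measurable (PiM (ksets n p) (\<lambda>_. lborel))"
proof (rule borel_measurableI_greater)
  fix c
  let ?P = "PiM (ksets n p) (\<lambda>_. lborel) :: (nat set \<Rightarrow> real) measure"
  let ?Q = "\<lambda>v Y. inner_on (ksets n l) v (mat_vec (ksets n l) (symdiff_matrix p Y) v)"
  have [measurable]: "?Q v \<in> borel_measurable ?P" for v
    unfolding inner_on_def mat_vec_def
    by (intro borel_measurable_sum borel_measurable_times borel_measurable_const measurable_symdiff_matrix)
  have "{Y\<in>space ?P. c < lmax_M n p l Y}
     = (\<Union>v\<in>PiE (ksets n l) (\<lambda>_. \<rat>). {Y\<in>space ?P. c * inner_on (ksets n l) v v < ?Q v Y})"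
    unfolding lmax_M_def
    using lambda_max_gt_iff_rational[OF finite_ksets ksets_nonempty[OF assms] symmetric_on_symdiff_matrix, of c]
    by auto
  also have "\<dots> \<in> sets ?P"
    by (intro sets.countable_UN'' countable_PiE countable_rat finite_ksets) measurable
  finally show "{Y\<in>space ?P. c < lmax_M n p l Y} \<in> sets ?P" .
qed

text \<open>Markov's inequality for the power \<open>2 * q\<close>, with the trace above the power
  of the eigenvalue. It is kept as a product, so that the bounds can be summed over \<open>q\<close>
  and \<open>t = 0\<close> is allowed.\<close>

lemma noise_lmax_moment_bound:
  assumes l: "l \<le> n" and t: "t \<ge> 0"
    and d: "\<And>U. U \<in> ksets n l \<Longrightarrow> card (slice_steps n p l U) = d" "d \<ge> 1"
  shows "measure (noise_law n p) {G\<in>space (noise_law n p). lmax_M n p l G \<ge> t} * t ^ (2 * q)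
      \<le> real (n choose l) * (gauss_moment (2 * q) * real d ^ q)"
proof -
  interpret prob_space "noise_law n p" by (rule prob_space_noise_law)
  let ?A = "{G\<in>space (noise_law n p). lmax_M n p l G \<ge> t}"
  let ?tr = "\<lambda>G. \<Sum>S\<in>ksets n l. mat_pow (ksets n l) (symdiff_matrix p G) (2 * q) S S"
  have [measurable]: "lmax_M n p l \<in> borel_measurable (noise_law n p)"
    using borel_measurable_lmax_M[OF l] measurable_cong_sets[OF sets_noise_law refl] by blast
  have A: "?A \<in> sets (noise_law n p)" by measurable
  have pow: "lmax_M n p l G ^ (2 * q) \<le> ?tr G" for G
    unfolding lmax_M_def
    by (intro eigenvalue_power_le_trace lambda_max_eigenvalue finite_ksets ksets_nonempty l
        symmetric_on_symdiff_matrix)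
  have "prob ?A * t ^ (2 * q) = (\<integral>G. indicator ?A G * t ^ (2 * q) \<partial>noise_law n p)"
    using A by simp
  also have "\<dots> \<le> (\<integral>G. ?tr G \<partial>noise_law n p)"
  proof (rule integral_mono)
    show "integrable (noise_law n p) (\<lambda>G. indicator ?A G * t ^ (2 * q))"
      using A by (intro integrable_mult_left integrable_real_indicator) (auto simp: emeasure_eq_measure)
    show "integrable (noise_law n p) ?tr"
      by (intro Bochner_Integration.integrable_sum integrable_mat_pow_noise[OF _ d])
    fix G
    have "indicator ?A G * t ^ (2 * q) \<le> lmax_M n p l G ^ (2 * q)"
      using t by (auto simp: indicator_def intro!: power_mono)
    then show "indicator ?A G * t ^ (2 * q) \<le> ?tr G" using pow order_trans by blast
  qed
  also have "\<dots> = (\<Sum>S\<in>ksets n l. \<integral>G. mat_pow (ksets n l) (symdiff_matrix p G) (2 * q) S S \<partial>noise_law n p)"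
    by (intro Bochner_Integration.integral_sum integrable_mat_pow_noise[OF _ d])
  also have "\<dots> \<le> (\<Sum>S\<in>ksets n l. gauss_moment (2 * q) * real d ^ q)"
    by (intro sum_mono expectation_mat_pow_noise_le[OF _ d])
  finally show ?thesis by (simp add: card_ksets)
qed

text \<open>Dividing \<open>gauss_moment (2 * q)\<close> by \<open>fact (2 * q)\<close> leaves
  \<open>1 / (2 ^ q * fact q)\<close>, so the weighted bounds sum to an exponential. Only even
  powers occur on the left, which yields \<open>cosh\<close>; bounding it below by half an
  exponential costs the factor 2.\<close>

lemma noise_lmax_tail:
  assumes l: "l \<le> n" and t: "t \<ge> 0"
    and d: "\<And>U. U \<in> ksets n l \<Longrightarrow> card (slice_steps n p l U) = d" "d \<ge> 1"
  shows "measure (noise_law n p) {G\<in>space (noise_law n p). lmax_M n p l G \<ge> t}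
      \<le> 2 * real (n choose l) * exp (- (t\<^sup>2 / (2 * real d)))"
proof -
  define P where "P = measure (noise_law n p) {G\<in>space (noise_law n p). lmax_M n p l G \<ge> t}"
  \<comment> \<open>This value minimises
    \<open>\<theta>\<^sup>2 * d / 2 - \<theta> * t\<close>.\<close>
  define \<theta> where "\<theta> = t / real d"
  define N where "N = real (n choose l)"
  have "(\<lambda>k. if even k then (\<theta> * t) ^ k / fact k else 0) sums cosh (\<theta> * t)"
    using cosh_converges[of "\<theta> * t"] by (simp add: field_simps if_distrib cong: if_cong)
  then have "(\<lambda>q. (\<theta> * t) ^ (2 * q) / fact (2 * q)) sums cosh (\<theta> * t)"
    by (subst (asm) sums_mono_reindex[of "\<lambda>q. 2 * q", symmetric]) (auto simp: strict_mono_def elim!: evenE)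
  then have 1: "(\<lambda>q. P * ((\<theta> * t) ^ (2 * q) / fact (2 * q))) sums (P * cosh (\<theta> * t))"
    by (rule sums_mult)
  have "(\<lambda>q. (\<theta>\<^sup>2 * d / 2) ^ q / fact q) sums exp (\<theta>\<^sup>2 * d / 2)"
    using exp_converges[of "\<theta>\<^sup>2 * d / 2"] by (simp add: field_simps)
  then have 2: "(\<lambda>q. N * ((\<theta>\<^sup>2 * d / 2) ^ q / fact q)) sums (N * exp (\<theta>\<^sup>2 * d / 2))"
    by (rule sums_mult)
  have "P * cosh (\<theta> * t) \<le> N * exp (\<theta>\<^sup>2 * d / 2)"
  proof (rule sums_le[OF _ 1 2])
    fix q
    have "P * ((\<theta> * t) ^ (2 * q) / fact (2 * q)) = (P * t ^ (2 * q)) * (\<theta> ^ (2 * q) / fact (2 * q))"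
      by (simp add: power_mult_distrib)
    also have "\<dots> \<le> (N * (gauss_moment (2 * q) * real d ^ q)) * (\<theta> ^ (2 * q) / fact (2 * q))"
      unfolding P_def N_def by (intro mult_right_mono noise_lmax_moment_bound l t d) (auto simp: zero_le_even_power)
    also have "\<dots> = N * ((\<theta>\<^sup>2 * d / 2) ^ q / fact q)"
      unfolding gauss_moment_even by (simp add: power_mult_distrib power_divide power_mult)
    finally show "P * ((\<theta> * t) ^ (2 * q) / fact (2 * q)) \<le> N * ((\<theta>\<^sup>2 * d / 2) ^ q / fact q)" .
  qed
  moreover have "P * (exp (\<theta> * t) / 2) \<le> P * cosh (\<theta> * t)"
    by (intro mult_left_mono) (auto simp: P_def cosh_def)
  ultimately have "P * exp (\<theta> * t) \<le> 2 * N * exp (\<theta>\<^sup>2 * d / 2)" by simp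
  then have "P \<le> 2 * N * exp (\<theta>\<^sup>2 * d / 2) / exp (\<theta> * t)" by (simp add: field_simps)
  also have "\<dots> = 2 * N * exp (\<theta>\<^sup>2 * d / 2 - \<theta> * t)" by (simp add: exp_diff)
  also have "\<theta>\<^sup>2 * d / 2 - \<theta> * t = - (t\<^sup>2 / (2 * real d))"
    using d(2) by (simp add: \<theta>_def power2_eq_square field_simps)
  finally show ?thesis by (simp add: P_def N_def)
qed

section \<open>The planted distribution\<close>

lemma
  shows integrable_gauss_exp: "integrable std_gaussian (\<lambda>x. exp (s * x))"
    and integral_gauss_exp: "(\<integral>x. exp (s * x) \<partial>std_gaussian) = exp (s\<^sup>2 / 2)"
proof -
  \<comment> \<open>Completing the square: the exponential tilt moves the mean to
    \<open>s\<close>.\<close>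
  have eq: "std_normal_density x * exp (s * x) = exp (s\<^sup>2 / 2) * normal_density s 1 x" for x
    by (simp add: normal_density_def exp_add[symmetric] power2_eq_square field_simps)
  show "integrable std_gaussian (\<lambda>x. exp (s * x))"
    by (subst integrable_std_gaussian_iff) (simp_all add: eq)
  show "(\<integral>x. exp (s * x) \<partial>std_gaussian) = exp (s\<^sup>2 / 2)"
    by (subst integral_std_gaussian) (simp_all add: eq)
qed

text \<open>Chernoff's bound with the tilt already absorbed into \<open>s\<close>. The inclusion
  \<open>sub\<close> lets an eigenvalue event be inserted directly, since monotonicity asks
  measurability only of the larger set.\<close>

lemma noise_linear_tail:
  fixes s :: "nat set \<Rightarrow> real"
  assumes var: "(\<Sum>E\<in>ksets n p. (s E)\<^sup>2) \<le> V"
    and sub: "A \<subseteq> {G\<in>space (noise_law n p). (\<Sum>E\<in>ksets n p. s E * G E) \<ge> c}"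
  shows "measure (noise_law n p) A \<le> exp (V / 2 - c)"
proof -
  interpret prob_space "noise_law n p" by (rule prob_space_noise_law)
  let ?f = "\<lambda>G. \<Prod>E\<in>ksets n p. exp (s E * G E)"
  let ?B = "{G\<in>space (noise_law n p). ?f G \<ge> exp c}"
  have f: "?f G = exp (\<Sum>E\<in>ksets n p. s E * G E)" for G by (simp add: exp_sum)
  have int: "integrable (noise_law n p) ?f"
    by (intro integrable_noise_prod integrable_gauss_exp)
  then have [measurable]: "?f \<in> borel_measurable (noise_law n p)" by simp
  have "?B \<in> events" by measurable
  then have "prob A \<le> prob ?B"
    using sub by (intro finite_measure_mono) (auto simp: f)
  also have "\<dots> \<le> (\<integral>G. ?f G \<partial>noise_law n p) / exp c"
    using int by (intro integral_Markov_inequality_measure[where A = "{}"]) (auto intro!: AE_I2 prod_nonneg)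
  also have "(\<integral>G. ?f G \<partial>noise_law n p) = (\<Prod>E\<in>ksets n p. exp ((s E)\<^sup>2 / 2))"
    by (subst integral_noise_prod[where f = "\<lambda>E x. exp (s E * x)"])
       (simp_all add: integrable_gauss_exp integral_gauss_exp)
  also have "\<dots> = exp ((\<Sum>E\<in>ksets n p. (s E)\<^sup>2) / 2)"
    by (simp add: exp_sum sum_divide_distrib)
  also have "\<dots> / exp c \<le> exp (V / 2) / exp c"
    using var by (intro divide_right_mono) auto
  finally show ?thesis by (simp add: exp_diff)
qed

section \<open>The sign character and the planted Rayleigh quotient\<close>

lemma signs_square: "x \<in> signs n \<Longrightarrow> i < n \<Longrightarrow> x i * x i = 1"
proof -
  assume "x \<in> signs n" "i < n"
  then have "x i \<in> {-1, 1}" unfolding signs_def by (intro PiE_mem[of x "{..<n}"]) auto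
  then show ?thesis by auto
qed

lemma prod_signs_square:
  assumes "x \<in> signs n" "S \<subseteq> {..<n}"
  shows "(\<Prod>i\<in>S. x i) * (\<Prod>i\<in>S. x i) = 1"
  unfolding prod.distrib[symmetric] using signs_square[OF assms(1)] assms(2) by (intro prod.neutral) auto

text \<open>The common part of \<open>S\<close> and \<open>E\<close> occurs twice on the right and
  contributes a square, which is 1. This multiplicativity aligns the vector of sign products with
  the spike.\<close>

lemma prod_signs_sym_diff:
  assumes x: "x \<in> signs n" and S: "S \<subseteq> {..<n}" and E: "E \<subseteq> {..<n}"
  shows "(\<Prod>i\<in>sym_diff S E. x i) = (\<Prod>i\<in>S. x i) * (\<Prod>i\<in>E. x i)"
proof -
  have fin: "finite S" "finite E" using S E finite_subset by blast+
  have "(\<Prod>i\<in>S. x i) = (\<Prod>i\<in>S - E. x i) * (\<Prod>i\<in>S \<inter> E. x i)"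
    using fin(1) by (metis Int_Diff_disjoint Un_Diff_Int finite_Diff finite_Int inf_commute prod.union_disjoint)
  moreover have "(\<Prod>i\<in>E. x i) = (\<Prod>i\<in>E - S. x i) * (\<Prod>i\<in>S \<inter> E. x i)"
    using fin(2) by (metis Int_Diff_disjoint Un_Diff_Int finite_Diff finite_Int inf_commute prod.union_disjoint)
  moreover have "(\<Prod>i\<in>sym_diff S E. x i) = (\<Prod>i\<in>S - E. x i) * (\<Prod>i\<in>E - S. x i)"
    using fin by (intro prod.union_disjoint) auto
  moreover have "(\<Prod>i\<in>S \<inter> E. x i) * (\<Prod>i\<in>S \<inter> E. x i) = 1"
    using S by (intro prod_signs_square[OF x]) auto
  ultimately show ?thesis by (simp add: mult_ac)
qed

definition planted :: "nat \<Rightarrow> nat \<Rightarrow> real \<Rightarrow> (nat \<Rightarrow> real) \<Rightarrow> (nat set \<Rightarrow> real) \<Rightarrow> nat set \<Rightarrow> real" where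
  "planted n p lam x G = (\<lambda>E\<in>ksets n p. lam * (\<Prod>i\<in>E. x i) + G E)"

text \<open>The multiplicity with which the noise entry \<open>G E\<close> enters the Rayleigh
  sum.\<close>

definition edge_count :: "nat \<Rightarrow> nat \<Rightarrow> nat \<Rightarrow> nat set \<Rightarrow> nat" where
  "edge_count n p l E = card {S\<in>ksets n l. E \<in> slice_steps n p l S}"

lemma edge_count_le: "edge_count n p l E \<le> n choose l"
  unfolding edge_count_def card_ksets[symmetric] by (intro card_mono) auto

lemma sum_slice_steps:
  "(\<Sum>S\<in>ksets n l. \<Sum>E\<in>slice_steps n p l S. f E) = (\<Sum>E\<in>ksets n p. real (edge_count n p l E) * f E)"
proof -
  have "(\<Sum>S\<in>ksets n l. \<Sum>E\<in>slice_steps n p l S. f E)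
      = (\<Sum>S\<in>ksets n l. \<Sum>E\<in>{E\<in>ksets n p. E \<in> slice_steps n p l S}. f E)"
    by (intro sum.cong refl) (auto simp: slice_steps_def)
  also have "\<dots> = (\<Sum>E\<in>ksets n p. \<Sum>S\<in>{S\<in>ksets n l. E \<in> slice_steps n p l S}. f E)"
    by (rule sum.swap_restrict) auto
  finally show ?thesis by (simp add: edge_count_def)
qed

lemma sum_edge_count:
  assumes "\<And>U. U \<in> ksets n l \<Longrightarrow> card (slice_steps n p l U) = d"
  shows "(\<Sum>E\<in>ksets n p. real (edge_count n p l E)) = real (n choose l) * real d"
  using sum_slice_steps[where n = n and p = p and l = l and f = "\<lambda>_. 1"] assms by (simp add: card_ksets)

text \<open>Rayleigh quotient of the vector \<open>S \<mapsto> \<Prod>i\<in>S. x i\<close>.\<close>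

lemma lmax_M_planted_ge:
  assumes x: "x \<in> signs n" and l: "l \<le> n"
    and d: "\<And>U. U \<in> ksets n l \<Longrightarrow> card (slice_steps n p l U) = d"
  shows "real (n choose l) * real d * lam
       + (\<Sum>E\<in>ksets n p. real (edge_count n p l E) * ((\<Prod>i\<in>E. x i) * G E))
     \<le> real (n choose l) * lmax_M n p l (planted n p lam x G)"
proof -
  define v where "v = (\<lambda>S. \<Prod>i\<in>S. x i)"
  let ?Y = "planted n p lam x G"
  have v2: "v S * v S = 1" if "S \<in> ksets n k" for S k
    unfolding v_def using that by (intro prod_signs_square[OF x]) (auto simp: ksets_def)
  have summand: "v S * (?Y E * v (sym_diff S E)) = lam + v E * G E"
    if S: "S \<in> ksets n l" and E: "E \<in> slice_steps n p l S" for S E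
  proof -
    have Ek: "E \<in> ksets n p" using E by (simp add: slice_steps_def)
    have "v (sym_diff S E) = v S * v E"
      unfolding v_def using S Ek by (intro prod_signs_sym_diff[OF x]) (auto simp: ksets_def)
    then have "v S * (?Y E * v (sym_diff S E)) = (v S * v S) * (lam * (v E * v E) + v E * G E)"
      using Ek by (simp add: planted_def v_def algebra_simps)
    then show ?thesis using v2[OF S] v2[OF Ek] by simp
  qed
  have "inner_on (ksets n l) v (mat_vec (ksets n l) (symdiff_matrix p ?Y) v)
      = (\<Sum>S\<in>ksets n l. \<Sum>E\<in>slice_steps n p l S. v S * (?Y E * v (sym_diff S E)))"
    unfolding inner_on_def mat_vec_def
    by (intro sum.cong refl) (simp only: sum_symdiff_matrix sum_distrib_left)
  also have "\<dots> = (\<Sum>S\<in>ksets n l. \<Sum>E\<in>slice_steps n p l S. lam + v E * G E)"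
    by (intro sum.cong refl summand)
  also have "\<dots> = real (n choose l) * real d * lam + (\<Sum>E\<in>ksets n p. real (edge_count n p l E) * (v E * G E))"
    using d by (simp add: sum.distrib sum_slice_steps card_ksets)
  finally have Q: "inner_on (ksets n l) v (mat_vec (ksets n l) (symdiff_matrix p ?Y) v)
      = real (n choose l) * real d * lam + (\<Sum>E\<in>ksets n p. real (edge_count n p l E) * (v E * G E))" .
  have "inner_on (ksets n l) v v = real (n choose l)"
    unfolding inner_on_def using v2 by (simp add: card_ksets)
  then show ?thesis
    using rayleigh_le_lambda_max[OF finite_ksets ksets_nonempty[OF l] symmetric_on_symdiff_matrix, of v p ?Y] Q
    by (simp add: lmax_M_def v_def mult.commute)
qed

text \<open>The signal alone gives the quotient \<open>lam * d\<close>, so a small top eigenvalue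
  forces the averaged noise down to \<open>- lam * d / 2\<close>. This is a lower tail of one linear
  form in Gaussians, so no union over subsets enters.\<close>

lemma noise_planted_lmax_tail:
  assumes x: "x \<in> signs n" and l: "l \<le> n" and lam: "lam \<ge> 0"
    and d: "\<And>U. U \<in> ksets n l \<Longrightarrow> card (slice_steps n p l U) = d"
  shows "measure (noise_law n p)
      {G\<in>space (noise_law n p). lmax_M n p l (planted n p lam x G) \<le> lam * real d / 2}
    \<le> exp (- (lam\<^sup>2 * real d / 8))"
proof -
  define N where "N = real (n choose l)"
  have N: "N > 0" using l by (simp add: N_def)
  define c where "c = (\<lambda>E. real (edge_count n p l E))"
  \<comment> \<open>The form \<open>Z\<close> used below has variance at most
    \<open>N\<^sup>2 * d\<close> and must fall to \<open>- N * d * lam / 2\<close>; the optimal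
    Chernoff tilt is the quotient \<open>lam / (2 * N)\<close>, negated for a lower tail.\<close>
  define s where "s = (\<lambda>E. - (lam / (2 * N)) * (c E * (\<Prod>i\<in>E. x i)))"
  have s2: "(s E)\<^sup>2 = (lam / (2 * N))\<^sup>2 * (c E)\<^sup>2" if "E \<in> ksets n p" for E
  proof -
    have "(\<Prod>i\<in>E. x i)\<^sup>2 = 1"
      unfolding power2_eq_square using that by (intro prod_signs_square[OF x]) (auto simp: ksets_def)
    then show ?thesis by (simp add: s_def power_divide power_mult_distrib)
  qed
  \<comment> \<open>The sum of squares is at most the maximal multiplicity \<open>N\<close> times
    the total multiplicity \<open>N * d\<close>, the latter by double counting.\<close>
  have "(\<Sum>E\<in>ksets n p. (c E)\<^sup>2) \<le> (\<Sum>E\<in>ksets n p. N * c E)"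
    unfolding power2_eq_square c_def N_def
    by (intro sum_mono mult_right_mono) (auto intro: edge_count_le)
  also have "\<dots> = N\<^sup>2 * real d"
    using sum_edge_count[OF d] by (simp add: sum_distrib_left[symmetric] c_def N_def power2_eq_square)
  finally have "(lam / (2 * N))\<^sup>2 * (\<Sum>E\<in>ksets n p. (c E)\<^sup>2) \<le> (lam / (2 * N))\<^sup>2 * (N\<^sup>2 * real d)"
    by (intro mult_left_mono) auto
  also have "\<dots> = lam\<^sup>2 * real d / 4"
    using N by (simp add: power_divide power_mult_distrib)
  finally have var: "(\<Sum>E\<in>ksets n p. (s E)\<^sup>2) \<le> lam\<^sup>2 * real d / 4"
    using s2 by (simp add: sum_distrib_left)
  have thr: "lam\<^sup>2 * real d / 4 \<le> (\<Sum>E\<in>ksets n p. s E * G E)"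
    if "lmax_M n p l (planted n p lam x G) \<le> lam * real d / 2" for G
  proof -
    define Z where "Z = (\<Sum>E\<in>ksets n p. c E * ((\<Prod>i\<in>E. x i) * G E))"
    have "N * lmax_M n p l (planted n p lam x G) \<le> N * (lam * real d / 2)"
      using that N by (intro mult_left_mono) auto
    then have "Z \<le> - (N * real d * lam / 2)"
      using lmax_M_planted_ge[OF x l d, where G = G and lam = lam]
      by (simp add: Z_def N_def c_def algebra_simps)
    then have "lam / (2 * N) * (N * real d * lam / 2) \<le> lam / (2 * N) * (- Z)"
      using lam N by (intro mult_left_mono) auto
    moreover have "(\<Sum>E\<in>ksets n p. s E * G E) = lam / (2 * N) * (- Z)"
      by (simp add: s_def Z_def sum_distrib_left sum_negf[symmetric] mult_ac)
    moreover have "lam / (2 * N) * (N * real d * lam / 2) = lam\<^sup>2 * real d / 4"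
      using N by (simp add: power2_eq_square)
    ultimately show ?thesis by linarith
  qed
  have "measure (noise_law n p)
      {G\<in>space (noise_law n p). lmax_M n p l (planted n p lam x G) \<le> lam * real d / 2}
    \<le> exp ((lam\<^sup>2 * real d / 4) / 2 - lam\<^sup>2 * real d / 4)"
    by (rule noise_linear_tail[OF var]) (use thr in auto)
  also have "(lam\<^sup>2 * real d / 4) / 2 - lam\<^sup>2 * real d / 4 = - (lam\<^sup>2 * real d / 8)" by simp
  finally show ?thesis .
qed

section \<open>Passing from the noise law to the spiked law\<close>

lemma finite_signs: "finite (signs n)"
  unfolding signs_def by (intro finite_PiE) auto

lemma prob_space_sign_law: "prob_space (sign_law n)"
  unfolding sign_law_def
  by (intro prob_space_uniform_count_measure finite_signs) (simp add: signs_def PiE_eq_empty_iff)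

lemma space_sign_law: "space (sign_law n) = signs n"
  by (simp add: sign_law_def space_uniform_count_measure)

lemma borel_measurable_sign_law [measurable]: "f \<in> borel_measurable (sign_law n)"
  by (simp add: sign_law_def measurable_def sets_uniform_count_measure space_uniform_count_measure)

lemma measurable_planted:
  "(\<lambda>(x, G). planted n p lam x G) \<in> measurable (sign_law n \<Otimes>\<^sub>M noise_law n p) (PiM (ksets n p) (\<lambda>_. lborel))"
  unfolding planted_def case_prod_unfold
proof (rule measurable_restrict)
  fix E assume "E \<in> ksets n p"
  then have [measurable]: "(\<lambda>G. G E) \<in> borel_measurable (noise_law n p)"
    using measurable_component_singleton[of E "ksets n p" "\<lambda>_. std_gaussian"]
      measurable_cong_sets[OF refl sets_std_gaussian]
    unfolding noise_law_def by blast
  have [measurable]: "(\<lambda>x. \<Prod>i\<in>E. x i) \<in> borel_measurable (sign_law n)"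
    by (rule borel_measurable_sign_law)
  show "(\<lambda>z. lam * (\<Prod>i\<in>E. fst z i) + snd z E) \<in> measurable (sign_law n \<Otimes>\<^sub>M noise_law n p) lborel"
    by simp measurable
qed

lemma spiked_law_planted:
  "spiked_law n p lam = distr (sign_law n \<Otimes>\<^sub>M noise_law n p) (PiM (ksets n p) (\<lambda>_. lborel))
     (\<lambda>(x, G). planted n p lam x G)"
  by (simp add: spiked_law_def planted_def)

lemma sets_spiked_law: "sets (spiked_law n p lam) = sets (PiM (ksets n p) (\<lambda>_. lborel))"
  by (simp add: spiked_law_def)

lemma prob_space_spiked_law: "prob_space (spiked_law n p lam)"
proof -
  interpret S: prob_space "sign_law n" by (rule prob_space_sign_law)
  interpret N: prob_space "noise_law n p" by (rule prob_space_noise_law)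
  interpret pair_prob_space "sign_law n" "noise_law n p" ..
  show ?thesis unfolding spiked_law_planted by (intro prob_space_distr measurable_planted)
qed

lemma borel_measurable_lmax_M_spiked:
  "l \<le> n \<Longrightarrow> lmax_M n p l \<in> borel_measurable (spiked_law n p lam)"
  using borel_measurable_lmax_M measurable_cong_sets[OF sets_spiked_law refl] by blast

text \<open>Conditioning on the sign vector: a bound valid for every fixed \<open>x\<close> passes
  to the mixture by Fubini.\<close>

lemma measure_spiked_law_le:
  assumes Q: "{Y\<in>space (spiked_law n p lam). Q Y} \<in> sets (spiked_law n p lam)"
    and le: "\<And>x. x \<in> signs n \<Longrightarrow>
      measure (noise_law n p) {G\<in>space (noise_law n p). Q (planted n p lam x G)} \<le> b"
    and b: "b \<ge> 0"
  shows "measure (spiked_law n p lam) {Y\<in>space (spiked_law n p lam). Q Y} \<le> b"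
proof -
  interpret S: prob_space "sign_law n" by (rule prob_space_sign_law)
  interpret N: prob_space "noise_law n p" by (rule prob_space_noise_law)
  interpret P: prob_space "spiked_law n p lam" by (rule prob_space_spiked_law)
  let ?A = "{Y\<in>space (spiked_law n p lam). Q Y}"
  let ?M = "sign_law n \<Otimes>\<^sub>M noise_law n p"
  let ?F = "\<lambda>(x, G). planted n p lam x G"
  have A: "?A \<in> sets (PiM (ksets n p) (\<lambda>_. lborel))" using Q by (simp add: sets_spiked_law)
  have pre: "?F -` ?A \<inter> space ?M \<in> sets ?M"
    by (rule measurable_sets[OF measurable_planted A])
  have sect: "Pair x -` (?F -` ?A \<inter> space ?M) = {G\<in>space (noise_law n p). Q (planted n p lam x G)}"
    if "x \<in> signs n" for x
  proof -
    have "planted n p lam x G \<in> space (spiked_law n p lam)" for G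
      by (simp add: spiked_law_planted space_PiM planted_def)
    then show ?thesis using that by (auto simp: space_pair_measure space_sign_law)
  qed
  have "emeasure (spiked_law n p lam) ?A = emeasure ?M (?F -` ?A \<inter> space ?M)"
    using emeasure_distr[OF measurable_planted A] by (simp add: spiked_law_planted)
  also have "\<dots> = (\<integral>\<^sup>+x. emeasure (noise_law n p) (Pair x -` (?F -` ?A \<inter> space ?M)) \<partial>sign_law n)"
    by (rule N.emeasure_pair_measure_alt[OF pre])
  also have "\<dots> \<le> (\<integral>\<^sup>+x. ennreal b \<partial>sign_law n)"
  proof (rule nn_integral_mono)
    fix x assume "x \<in> space (sign_law n)"
    then have x: "x \<in> signs n" by (simp add: space_sign_law)
    show "emeasure (noise_law n p) (Pair x -` (?F -` ?A \<inter> space ?M)) \<le> ennreal b"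
      unfolding sect[OF x] N.emeasure_eq_measure using le[OF x] by (rule ennreal_leI)
  qed
  also have "\<dots> = ennreal b" by (simp add: S.emeasure_space_1)
  finally show ?thesis using b by (simp add: P.emeasure_eq_measure)
qed

section \<open>The two tail bounds for admissible orders\<close>

context
  fixes n p l :: nat and lam :: real
  assumes p: "even p" "p \<ge> 2" and l: "p div 2 \<le> l" "l \<le> n - p div 2" and lam: "lam \<ge> 0"
begin

text \<open>As \<open>p div 2\<close> is at least 1 and at most \<open>l\<close>, the subtraction in
  \<open>l \<le> n - p div 2\<close> is not truncated.\<close>

lemma slice_bounds: "l \<le> n" "n \<ge> 1"
  using p l by auto

lemma slice_degree:
  obtains d where "real d = d_ell n p l" "d \<ge> 1" "\<And>U. U \<in> ksets n l \<Longrightarrow> card (slice_steps n p l U) = d"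
proof
  let ?d = "((n - l) choose (p div 2)) * (l choose (p div 2))"
  show "real ?d = d_ell n p l" by (simp add: d_ell_def)
  show "?d \<ge> 1" using l slice_bounds by (simp add: Suc_le_eq)
  show "card (slice_steps n p l U) = ?d" if "U \<in> ksets n l" for U
    using card_slice_steps[OF that, of "p div 2"] p by simp
qed

text \<open>At signal strength zero every conditional law is the noise law itself. The threshold
  \<open>t = lam * d / 2\<close> turns \<open>t\<^sup>2 / (2 * d)\<close> into
  \<open>lam\<^sup>2 * d / 8\<close>.\<close>

lemma null_lmax_M_tail:
  "measure (spiked_law n p 0) {Y\<in>space (spiked_law n p 0). lmax_M n p l Y \<ge> lam * d_ell n p l / 2}
    \<le> 2 * real n ^ l * exp (- (lam\<^sup>2 * d_ell n p l / 8))"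
proof (rule measure_spiked_law_le)
  have [measurable]: "lmax_M n p l \<in> borel_measurable (spiked_law n p 0)"
    by (rule borel_measurable_lmax_M_spiked[OF slice_bounds(1)])
  show "{Y\<in>space (spiked_law n p 0). lmax_M n p l Y \<ge> lam * d_ell n p l / 2} \<in> sets (spiked_law n p 0)"
    by measurable
  obtain d where d: "real d = d_ell n p l" "d \<ge> 1"
    "\<And>U. U \<in> ksets n l \<Longrightarrow> card (slice_steps n p l U) = d" by (rule slice_degree) blast
  fix x
  \<comment> \<open>Points of the noise space are extensional, so restricting them to
    \<open>ksets n p\<close> changes nothing.\<close>
  have "planted n p 0 x G = G" if "G \<in> space (noise_law n p)" for G
    using that by (auto simp: planted_def space_noise_law PiE_def extensional_def restrict_def)
  then have "{G\<in>space (noise_law n p). lam * d_ell n p l / 2 \<le> lmax_M n p l (planted n p 0 x G)}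
     = {G\<in>space (noise_law n p). lam * d_ell n p l / 2 \<le> lmax_M n p l G}" by auto
  then have "measure (noise_law n p)
      {G\<in>space (noise_law n p). lam * d_ell n p l / 2 \<le> lmax_M n p l (planted n p 0 x G)}
    \<le> 2 * real (n choose l) * exp (- ((lam * d_ell n p l / 2)\<^sup>2 / (2 * real d)))"
    using noise_lmax_tail[OF slice_bounds(1) _ d(3,2), of "lam * d_ell n p l / 2"] lam
    by (simp add: d(1)[symmetric])
  also have "(lam * d_ell n p l / 2)\<^sup>2 / (2 * real d) = lam\<^sup>2 * d_ell n p l / 8"
    using d(2) by (simp add: d(1)[symmetric] power2_eq_square field_simps)
  also have "2 * real (n choose l) * exp (- (lam\<^sup>2 * d_ell n p l / 8))
      \<le> 2 * real n ^ l * exp (- (lam\<^sup>2 * d_ell n p l / 8))"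
  proof -
    have "real (n choose l) \<le> real (n ^ l)"
      using binomial_le_pow[OF slice_bounds(1)] of_nat_le_iff by blast
    then show ?thesis by simp
  qed
  finally show "measure (noise_law n p)
      {G\<in>space (noise_law n p). lam * d_ell n p l / 2 \<le> lmax_M n p l (planted n p 0 x G)}
    \<le> 2 * real n ^ l * exp (- (lam\<^sup>2 * d_ell n p l / 8))" .
qed simp

lemma spiked_lmax_M_tail:
  "measure (spiked_law n p lam) {Y\<in>space (spiked_law n p lam). lmax_M n p l Y \<le> lam * d_ell n p l / 2}
    \<le> 2 * real n ^ l * exp (- (lam\<^sup>2 * d_ell n p l / 8))"
proof (rule measure_spiked_law_le)
  have [measurable]: "lmax_M n p l \<in> borel_measurable (spiked_law n p lam)"
    by (rule borel_measurable_lmax_M_spiked[OF slice_bounds(1)])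
  show "{Y\<in>space (spiked_law n p lam). lmax_M n p l Y \<le> lam * d_ell n p l / 2} \<in> sets (spiked_law n p lam)"
    by measurable
  obtain d where d: "real d = d_ell n p l" "d \<ge> 1"
    "\<And>U. U \<in> ksets n l \<Longrightarrow> card (slice_steps n p l U) = d" by (rule slice_degree) blast
  fix x assume x: "x \<in> signs n"
  have "measure (noise_law n p)
      {G\<in>space (noise_law n p). lmax_M n p l (planted n p lam x G) \<le> lam * d_ell n p l / 2}
    \<le> exp (- (lam\<^sup>2 * d_ell n p l / 8))"
    using noise_planted_lmax_tail[OF x slice_bounds(1) lam d(3)] by (simp add: d(1))
  \<comment> \<open>The planted bound carries no prefactor; the one inserted here is at least 1 and
    gives both errors the same form.\<close>
  also have "1 * \<dots> \<le> 2 * real n ^ l * \<dots>"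
  proof (rule mult_right_mono)
    have "1 \<le> real n ^ l" using slice_bounds by (intro one_le_power) simp
    then show "1 \<le> 2 * real n ^ l" by simp
  qed simp
  finally show "measure (noise_law n p)
      {G\<in>space (noise_law n p). lmax_M n p l (planted n p lam x G) \<le> lam * d_ell n p l / 2}
    \<le> 2 * real n ^ l * exp (- (lam\<^sup>2 * d_ell n p l / 8))" by simp
qed simp

end

theorem theorem2:
  fixes p :: nat
  assumes "even p" and "p \<ge> 2"
  shows
    "(\<forall>(n::nat) (l::nat) (lam::real).
        p div 2 \<le> l \<and> l \<le> n - p div 2 \<and> lam \<ge> 0 \<longrightarrow>
        max (measure (spiked_law n p 0)
               {Y \<in> space (spiked_law n p 0). lmax_M n p l Y \<ge> lam * d_ell n p l / 2})
            (measure (spiked_law n p lam)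
               {Y \<in> space (spiked_law n p lam). lmax_M n p l Y \<le> lam * d_ell n p l / 2})
        \<le> 2 * real n ^ l * exp (- (lam\<^sup>2 * d_ell n p l / 8)))
     \<and>
     (\<forall>(lam :: nat \<Rightarrow> real) (l :: nat \<Rightarrow> nat).
        (\<forall>n. lam n \<ge> 0) \<longrightarrow>
        (\<forall>\<^sub>F n in sequentially. p div 2 \<le> l n \<and> l n \<le> n - p div 2) \<longrightarrow>
        filterlim (\<lambda>n. lam n ^ 2 * d_ell n p (l n) / 8 - real (l n) * ln (real n))
          at_top sequentially \<longrightarrow>
        strong_detection (\<lambda>n. spiked_law n p 0) (\<lambda>n. spiked_law n p (lam n))
          (\<lambda>n Y. if lmax_M n p (l n) Y \<ge> lam n * d_ell n p (l n) / 2 then 1 else 0))"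
proof (intro conjI allI impI)
  fix n l :: nat and lam :: real
  assume "p div 2 \<le> l \<and> l \<le> n - p div 2 \<and> lam \<ge> 0"
  then show "max (measure (spiked_law n p 0)
               {Y \<in> space (spiked_law n p 0). lmax_M n p l Y \<ge> lam * d_ell n p l / 2})
            (measure (spiked_law n p lam)
               {Y \<in> space (spiked_law n p lam). lmax_M n p l Y \<le> lam * d_ell n p l / 2})
        \<le> 2 * real n ^ l * exp (- (lam\<^sup>2 * d_ell n p l / 8))"
    using null_lmax_M_tail[OF assms] spiked_lmax_M_tail[OF assms] by (intro max.boundedI) auto
next
  fix lam :: "nat \<Rightarrow> real" and l :: "nat \<Rightarrow> nat"
  assume lam: "\<forall>n. lam n \<ge> 0"
    and l: "\<forall>\<^sub>F n in sequentially. p div 2 \<le> l n \<and> l n \<le> n - p div 2"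
    and lim: "filterlim (\<lambda>n. lam n ^ 2 * d_ell n p (l n) / 8 - real (l n) * ln (real n)) at_top sequentially"
  let ?t = "\<lambda>n. lam n * d_ell n p (l n) / 2"
  let ?f = "\<lambda>n Y. if lmax_M n p (l n) Y \<ge> ?t n then 1 else 0 :: nat"
  \<comment> \<open>The common error bound with \<open>n ^ l\<close> moved into the exponent; the
    two agree once \<open>n \<ge> 1\<close>, where \<open>ln\<close> inverts
    \<open>exp\<close>.\<close>
  define r where "r = (\<lambda>n. 2 * exp (- (lam n ^ 2 * d_ell n p (l n) / 8 - real (l n) * ln (real n))))"
  have "((\<lambda>x::real. 2 * exp (- x)) \<longlongrightarrow> 0) at_top" by real_asymp
  then have "r \<longlonglongrightarrow> 0" unfolding r_def using lim by (rule filterlim_compose)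
  then have r: "(\<lambda>n. 1 - r n) \<longlonglongrightarrow> 1" using tendsto_diff[OF tendsto_const[of 1]] by fastforce
  have r_eq: "2 * real n ^ l n * exp (- ((lam n)\<^sup>2 * d_ell n p (l n) / 8)) = r n" if "n \<ge> 1" for n
  proof -
    have "real n ^ l n = exp (real (l n) * ln (real n))" using that by (simp add: exp_of_nat_mult)
    then show ?thesis by (simp add: r_def mult_exp_exp)
  qed
  have P1: "1 - r n \<le> measure (spiked_law n p (lam n)) {Y\<in>space (spiked_law n p (lam n)). ?f n Y = 1}"
    and P0: "1 - r n \<le> measure (spiked_law n p 0) {Y\<in>space (spiked_law n p 0). ?f n Y = 0}"
    if n: "p div 2 \<le> l n \<and> l n \<le> n - p div 2" for n
  proof -
    have ln: "l n \<le> n" "n \<ge> 1" using slice_bounds[OF assms, of "l n" n] n by auto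
    interpret P1: prob_space "spiked_law n p (lam n)" by (rule prob_space_spiked_law)
    interpret P0: prob_space "spiked_law n p 0" by (rule prob_space_spiked_law)
    have [measurable]: "lmax_M n p (l n) \<in> borel_measurable (spiked_law n p \<mu>)" for \<mu>
      by (rule borel_measurable_lmax_M_spiked[OF ln(1)])
    have "1 - r n \<le> 1 - P1.prob {Y\<in>space (spiked_law n p (lam n)). lmax_M n p (l n) Y \<le> ?t n}"
      using spiked_lmax_M_tail[OF assms, of "l n" n "lam n"] n lam r_eq[OF ln(2)] by auto
    also have "\<dots> = P1.prob {Y\<in>space (spiked_law n p (lam n)). \<not> lmax_M n p (l n) Y \<le> ?t n}"
      by (rule P1.prob_neg[symmetric]) measurable
    \<comment> \<open>An inclusion only, since the test also outputs 1 at equality; under the null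
      law the corresponding events coincide.\<close>
    also have "\<dots> \<le> P1.prob {Y\<in>space (spiked_law n p (lam n)). ?f n Y = 1}"
      by (rule P1.finite_measure_mono) (auto, measurable)
    finally show "1 - r n \<le> P1.prob {Y\<in>space (spiked_law n p (lam n)). ?f n Y = 1}" .
    have "1 - r n \<le> 1 - P0.prob {Y\<in>space (spiked_law n p 0). lmax_M n p (l n) Y \<ge> ?t n}"
      using null_lmax_M_tail[OF assms, of "l n" n "lam n"] n lam r_eq[OF ln(2)] by auto
    also have "\<dots> = P0.prob {Y\<in>space (spiked_law n p 0). \<not> lmax_M n p (l n) Y \<ge> ?t n}"
      by (rule P0.prob_neg[symmetric]) measurable
    also have "\<dots> = P0.prob {Y\<in>space (spiked_law n p 0). ?f n Y = 0}"
      by (rule arg_cong[where f = P0.prob]) auto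
    finally show "1 - r n \<le> P0.prob {Y\<in>space (spiked_law n p 0). ?f n Y = 0}" .
  qed
  have le1: "measure (spiked_law n p \<mu>) A \<le> 1" for n \<mu> A
    by (rule prob_space.prob_le_1[OF prob_space_spiked_law])
  show "strong_detection (\<lambda>n. spiked_law n p 0) (\<lambda>n. spiked_law n p (lam n)) ?f"
    unfolding strong_detection_def
  proof
    show "(\<lambda>n. measure (spiked_law n p (lam n)) {Y\<in>space (spiked_law n p (lam n)). ?f n Y = 1}) \<longlonglongrightarrow> 1"
      by (rule tendsto_sandwich[OF eventually_mono[OF l P1] always_eventually r tendsto_const])
         (simp_all add: le1)
    show "(\<lambda>n. measure (spiked_law n p 0) {Y\<in>space (spiked_law n p 0). ?f n Y = 0}) \<longlonglongrightarrow> 1"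
      by (rule tendsto_sandwich[OF eventually_mono[OF l P0] always_eventually r tendsto_const])
         (simp_all add: le1)
  qed
qed

end
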